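(* Let $\mathbb{H}$ be the division ring of quaternions and let $n$ be a positive integer. Let $S$ be a Sylvester-Gallai configuration in $\mathbb{P}^n(\mathbb{H})$, i.e. a finite set of points of $\mathbb{P}^n(\mathbb{H})$ such that for any distinct $x,y\in S$ there exists $z\in S$ such that $x,y,z$ are distinct collinear points. Then $S$ is contained in a three-dimensional flat of $\mathbb{P}^n(\mathbb{H})$ (a condition which is vacuous if $n\le 3$).
   Context: For a division ring $\mathbb{D}$, $\mathbb{P}^n(\mathbb{D})$ is the $n$-dimensional projective space over $\mathbb{D}$: regard $\mathbb{D}^{n+1}$ as the right vector space of column vectors over $\mathbb{D}$ (scalars act from the right); the $k$-dimensional flats of $\mathbb{P}^n(\mathbb{D})$ are the $(k+1)$-dimensional subspaces of $\mathbb{D}^{n+1}$. Points are $0$-dimensional flats, i.e. $1$-dimensional subspaces; lines are $1$-dimensional flats. Three points are collinear if they lie on a common line, and a point lies in a flat if the corresponding $1$-dimensional subspace is contained in the subspace corresponding to the flat. *)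

theory Defs
  imports "HOL-Analysis.Finite_Cartesian_Product"
begin

section \<open>Quaternions\<close>

datatype quat = Quat (qre: real) (qi: real) (qj: real) (qk: real)

lemma quat_eq_iff: "x = y \<longleftrightarrow> qre x = qre y \<and> qi x = qi y \<and> qj x = qj y \<and> qk x = qk y"
  by (auto intro: quat.expand)

instantiation quat :: division_ring
begin

definition "0 = Quat 0 0 0 0"

definition "1 = Quat 1 0 0 0"

definition "x + y = Quat (qre x + qre y) (qi x + qi y) (qj x + qj y) (qk x + qk y)"

definition "- x = Quat (- qre x) (- qi x) (- qj x) (- qk x)"

definition "x - y = Quat (qre x - qre y) (qi x - qi y) (qj x - qj y) (qk x - qk y)"

definition "x * y = Quat
   (qre x * qre y - qi x * qi y - qj x * qj y - qk x * qk y)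
   (qre x * qi y + qi x * qre y + qj x * qk y - qk x * qj y)
   (qre x * qj y - qi x * qk y + qj x * qre y + qk x * qi y)
   (qre x * qk y + qi x * qj y - qj x * qi y + qk x * qre y)"

definition "inverse x =
  (let N = (qre x)\<^sup>2 + (qi x)\<^sup>2 + (qj x)\<^sup>2 + (qk x)\<^sup>2
   in Quat (qre x / N) (- qi x / N) (- qj x / N) (- qk x / N))"

definition "x div y = x * inverse y" for x y :: quat

lemmas quat_ops_defs =
  zero_quat_def one_quat_def plus_quat_def uminus_quat_def minus_quat_def times_quat_def

instance
proof
  fix x :: quat
  assume "x \<noteq> 0"
  define N where "N = (qre x)\<^sup>2 + (qi x)\<^sup>2 + (qj x)\<^sup>2 + (qk x)\<^sup>2"
  have "N \<noteq> 0"
    using \<open>x \<noteq> 0\<close> unfolding N_def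
    by (auto simp: quat_eq_iff zero_quat_def add_nonneg_eq_0_iff)
  then have "qre x * qre x / N + qi x * qi x / N + qj x * qj x / N + qk x * qk x / N = 1"
    by (simp add: add_divide_distrib [symmetric] N_def power2_eq_square)
  moreover have "inverse x = Quat (qre x / N) (- qi x / N) (- qj x / N) (- qk x / N)"
    by (simp add: inverse_quat_def N_def Let_def)
  ultimately show "inverse x * x = 1" "x * inverse x = 1"
    by (simp_all add: quat_eq_iff one_quat_def times_quat_def mult.commute)
qed (simp_all add: quat_eq_iff quat_ops_defs algebra_simps divide_quat_def inverse_quat_def)

end


section \<open>Right vector spaces of column vectors over a division ring\<close>

text \<open>
  The library's \<^locale>\<open>vector_space\<close> requires commutative scalars, and
  \<^const>\<open>vector_scalar_mult\<close> acts from the left, so the notions below follow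
  its definitions with the scalars on the right.
\<close>

definition rscale :: "'a::division_ring ^ 'n \<Rightarrow> 'a \<Rightarrow> 'a ^ 'n"  (infixl \<open>*r\<close> 75)
  where "v *r c = (\<chi> i. v $ i * c)"

definition rsubspace :: "('a::division_ring ^ 'n) set \<Rightarrow> bool"
  where "rsubspace V \<longleftrightarrow>
    0 \<in> V \<and> (\<forall>x\<in>V. \<forall>y\<in>V. x + y \<in> V) \<and> (\<forall>x\<in>V. \<forall>c. x *r c \<in> V)"

definition rspan :: "('a::division_ring ^ 'n) set \<Rightarrow> ('a ^ 'n) set"
  where "rspan B = {(\<Sum>v\<in>t. v *r u v) | t u. finite t \<and> t \<subseteq> B}"

definition rindependent :: "('a::division_ring ^ 'n) set \<Rightarrow> bool"
  where "rindependent B \<longleftrightarrow>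
    (\<forall>t u. finite t \<longrightarrow> t \<subseteq> B \<longrightarrow> (\<Sum>v\<in>t. v *r u v) = 0 \<longrightarrow> (\<forall>v\<in>t. u v = 0))"

definition has_rdim :: "('a::division_ring ^ 'n) set \<Rightarrow> nat \<Rightarrow> bool"
  where "has_rdim V k \<longleftrightarrow> (\<exists>B. finite B \<and> card B = k \<and> rindependent B \<and> rspan B = V)"


section \<open>Projective space\<close>

text \<open>
  The ambient space is the projective space of dimension \<open>CARD('n) - 1\<close>; flats (and hence
  points) are represented by the subspaces themselves, so that incidence is inclusion.
\<close>

definition proj_flat :: "nat \<Rightarrow> ('a::division_ring ^ 'n) set \<Rightarrow> bool"
  where "proj_flat k F \<longleftrightarrow> rsubspace F \<and> has_rdim F (k + 1)"

abbreviation proj_point :: "('a::division_ring ^ 'n) set \<Rightarrow> bool"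
  where "proj_point \<equiv> proj_flat 0"

abbreviation proj_line :: "('a::division_ring ^ 'n) set \<Rightarrow> bool"
  where "proj_line \<equiv> proj_flat 1"

definition proj_collinear ::
    "('a::division_ring ^ 'n) set \<Rightarrow> ('a ^ 'n) set \<Rightarrow> ('a ^ 'n) set \<Rightarrow> bool"
  where "proj_collinear x y z \<longleftrightarrow> (\<exists>L. proj_line L \<and> x \<subseteq> L \<and> y \<subseteq> L \<and> z \<subseteq> L)"

definition sylvester_gallai :: "('a::division_ring ^ 'n) set set \<Rightarrow> bool"
  where "sylvester_gallai S \<longleftrightarrow>
    finite S \<and> (\<forall>x\<in>S. proj_point x) \<and>
    (\<forall>x\<in>S. \<forall>y\<in>S. x \<noteq> y \<longrightarrow> (\<exists>z\<in>S. z \<noteq> x \<and> z \<noteq> y \<and> proj_collinear x y z))"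

end

theory Submission
  imports Defs
begin

text \<open>
  Choose a vector \<open>v x\<close> spanning each of the \<open>n\<close> points \<open>x\<close>.  Every collinear triple of points
  gives a relation between three of these vectors.  A triple on a line with \<open>r\<close> points gets weight
  \<open>1 / (r - 2)\<close>; then every pair of points lies in triples of total weight \<open>1\<close>, so every point
  lies in triples of total weight \<open>(n - 1) / 2\<close>, and all triples together weigh
  \<open>n (n - 1) / 6\<close>.  Rescaling the points by positive reals, and normalising each row, one can
  make all weighted columns of the relation matrix have almost the same squared norm
  \<open>(n - 1) / 6\<close>.  The Gram matrix of the columns then has almost constant diagonal, while its
  off-diagonal part is small in the Frobenius norm by the Cauchy--Schwarz inequality; this bounds
  its corank by \<open>4 n / (n + 3) < 4\<close>.  Hence at most three of the coordinate functions of the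
  vectors are independent, so the points even lie in a plane.  Only the multiplicativity of the norm
  and the identity \<open>Re (x y) = Re (y x)\<close> are used, so noncommutativity is harmless.
  This is the design matrix method of Barak, Dvir, Saraf, Wigderson and Yehudayoff.
\<close>

section \<open>Conjugation and norm of quaternions\<close>

text \<open>Real scalars are central, so rows and columns can later be multiplied by positive reals
  although quaternions do not commute.\<close>

instantiation quat :: real_algebra_1
begin

definition "r *\<^sub>R x = Quat (r * qre x) (r * qi x) (r * qj x) (r * qk x)"

instance
  by standard (simp_all add: quat_eq_iff scaleR_quat_def quat_ops_defs algebra_simps)

end

definition qcnj :: "quat \<Rightarrow> quat"
  where "qcnj x = Quat (qre x) (- qi x) (- qj x) (- qk x)"

definition qnormsq :: "quat \<Rightarrow> real"
  where "qnormsq x = (qre x)\<^sup>2 + (qi x)\<^sup>2 + (qj x)\<^sup>2 + (qk x)\<^sup>2"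

lemma of_real_quat: "of_real r = Quat r 0 0 0"
  by (simp add: of_real_def scaleR_quat_def one_quat_def)

lemma quat_sel_simps [simp]:
  "qre (x + y) = qre x + qre y" "qi (x + y) = qi x + qi y"
  "qj (x + y) = qj x + qj y" "qk (x + y) = qk x + qk y"
  "qre 0 = 0" "qi 0 = 0" "qj 0 = 0" "qk 0 = 0"
  "qre (r *\<^sub>R x) = r * qre x" "qi (r *\<^sub>R x) = r * qi x"
  "qj (r *\<^sub>R x) = r * qj x" "qk (r *\<^sub>R x) = r * qk x"
  "qre 1 = 1"
  by (simp_all add: quat_ops_defs scaleR_quat_def)

lemma quat_sel_sum:
  "qre (\<Sum>i\<in>A. f i) = (\<Sum>i\<in>A. qre (f i))" "qi (\<Sum>i\<in>A. f i) = (\<Sum>i\<in>A. qi (f i))"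
  "qj (\<Sum>i\<in>A. f i) = (\<Sum>i\<in>A. qj (f i))" "qk (\<Sum>i\<in>A. f i) = (\<Sum>i\<in>A. qk (f i))"
  by (induction A rule: infinite_finite_induct; simp)+

lemma qcnj_simps [simp]:
  "qcnj 0 = 0" "qcnj 1 = 1" "qcnj (qcnj x) = x" "qcnj (x + y) = qcnj x + qcnj y"
  "qcnj (x * y) = qcnj y * qcnj x" "qcnj (r *\<^sub>R x) = r *\<^sub>R qcnj x" "qcnj x = 0 \<longleftrightarrow> x = 0"
  by (auto simp: qcnj_def quat_eq_iff quat_ops_defs scaleR_quat_def algebra_simps)

lemma qcnj_sum: "qcnj (\<Sum>i\<in>A. f i) = (\<Sum>i\<in>A. qcnj (f i))"
  by (induction A rule: infinite_finite_induct) auto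

lemma qnormsq_nonneg [simp]: "0 \<le> qnormsq x"
  by (simp add: qnormsq_def)

lemma qnormsq_eq_0_iff [simp]: "qnormsq x = 0 \<longleftrightarrow> x = 0"
  by (auto simp: qnormsq_def quat_eq_iff add_nonneg_eq_0_iff)

lemma qnormsq_pos_iff [simp]: "0 < qnormsq x \<longleftrightarrow> x \<noteq> 0"
  by (metis less_le qnormsq_eq_0_iff qnormsq_nonneg)

lemma qnormsq_mult: "qnormsq (x * y) = qnormsq x * qnormsq y"
  by (simp add: qnormsq_def times_quat_def power2_eq_square algebra_simps)

lemma qnormsq_qcnj [simp]: "qnormsq (qcnj x) = qnormsq x"
  by (simp add: qnormsq_def qcnj_def)

lemma qnormsq_scaleR: "qnormsq (r *\<^sub>R x) = r\<^sup>2 * qnormsq x"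
  by (simp add: qnormsq_def power_mult_distrib algebra_simps)

lemma qcnj_mult_self: "qcnj x * x = of_real (qnormsq x)" "x * qcnj x = of_real (qnormsq x)"
  by (auto simp: qcnj_def qnormsq_def of_real_quat times_quat_def power2_eq_square)

lemma qre_of_real [simp]: "qre (of_real r) = r"
  by (simp add: of_real_quat)

lemma qre_mult_commute: "qre (x * y) = qre (y * x)"
  by (simp add: times_quat_def)

text \<open>Young's inequality, applied to each of the four signed products that make up the real
  part. The parameter \<open>t\<close> is later tuned to balance two error terms.\<close>

lemma qre_mult_ge:
  assumes "t > 0"
  shows "qre (x * y) \<ge> - (t * qnormsq x) - qnormsq y / (4 * t)"
proof -
  define s where "s = 2 * t"
  have s: "s > 0" "t = s / 2" using assms by (simp_all add: s_def)
  have *: "a * b \<ge> - (s * a\<^sup>2 / 2) - b\<^sup>2 / (2 * s)" "- (a * b) \<ge> - (s * a\<^sup>2 / 2) - b\<^sup>2 / (2 * s)" for a b :: real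
  proof -
    have "(s * a + b)\<^sup>2 / (2 * s) \<ge> 0" "(s * a - b)\<^sup>2 / (2 * s) \<ge> 0" using s by simp_all
    then show "a * b \<ge> - (s * a\<^sup>2 / 2) - b\<^sup>2 / (2 * s)" "- (a * b) \<ge> - (s * a\<^sup>2 / 2) - b\<^sup>2 / (2 * s)"
      using s by (simp_all add: power2_eq_square field_simps)
  qed
  have "qre (x * y) = qre x * qre y + - (qi x * qi y) + - (qj x * qj y) + - (qk x * qk y)"
    by (simp add: times_quat_def)
  moreover have "t * qnormsq x = s * (qre x)\<^sup>2 / 2 + s * (qi x)\<^sup>2 / 2 + s * (qj x)\<^sup>2 / 2 + s * (qk x)\<^sup>2 / 2"
    by (simp add: qnormsq_def s field_simps)
  moreover have "qnormsq y / (4 * t) = (qre y)\<^sup>2 / (2 * s) + (qi y)\<^sup>2 / (2 * s) + (qj y)\<^sup>2 / (2 * s) + (qk y)\<^sup>2 / (2 * s)"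
    by (simp add: qnormsq_def s add_divide_distrib)
  ultimately show ?thesis
    using *(1)[of "qre x" "qre y"] *(2)[of "qi x" "qi y"] *(2)[of "qj x" "qj y"] *(2)[of "qk x" "qk y"]
    by linarith
qed

text \<open>Jensen's inequality for squares: the variance about the weighted mean \<open>m\<close>
  is nonnegative.\<close>

lemma weighted_sum_squared_le:
  fixes w f :: "'r \<Rightarrow> real"
  assumes "\<And>r. r \<in> A \<Longrightarrow> w r \<ge> 0" "(\<Sum>r\<in>A. w r) = 1"
  shows "(\<Sum>r\<in>A. w r * f r)\<^sup>2 \<le> (\<Sum>r\<in>A. w r * (f r)\<^sup>2)"
proof -
  define m where "m = (\<Sum>r\<in>A. w r * f r)"
  have "0 \<le> (\<Sum>r\<in>A. w r * (f r - m)\<^sup>2)"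
    using assms(1) by (intro sum_nonneg) auto
  also have "\<dots> = (\<Sum>r\<in>A. w r * (f r)\<^sup>2 - 2 * m * (w r * f r) + m\<^sup>2 * w r)"
    by (rule sum.cong) (auto simp: power2_eq_square algebra_simps)
  also have "\<dots> = (\<Sum>r\<in>A. w r * (f r)\<^sup>2) - 2 * m * m + m\<^sup>2 * 1"
    unfolding sum.distrib sum_subtractf sum_distrib_left[symmetric] assms(2) m_def[symmetric] ..
  finally show ?thesis
    by (simp add: m_def[symmetric] power2_eq_square)
qed

lemma qnormsq_weighted_sum_le:
  assumes "\<And>r. r \<in> A \<Longrightarrow> w r \<ge> 0" "(\<Sum>r\<in>A. w r) = 1"
  shows "qnormsq (\<Sum>r\<in>A. w r *\<^sub>R x r) \<le> (\<Sum>r\<in>A. w r * qnormsq (x r))"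
  unfolding qnormsq_def quat_sel_sum quat_sel_simps distrib_left sum.distrib
  by (intro add_mono weighted_sum_squared_le assms)


section \<open>Orthonormal families of quaternion-valued functions\<close>

text \<open>Conjugating the first argument makes the form linear over right scalars in the second,
  matching coefficients that act from the right.\<close>

definition qinner :: "'i set \<Rightarrow> ('i \<Rightarrow> quat) \<Rightarrow> ('i \<Rightarrow> quat) \<Rightarrow> quat"
  where "qinner I f g = (\<Sum>i\<in>I. qcnj (f i) * g i)"

definition qorthonormal :: "'i set \<Rightarrow> nat \<Rightarrow> (nat \<Rightarrow> 'i \<Rightarrow> quat) \<Rightarrow> bool"
  where "qorthonormal I k f \<longleftrightarrow> (\<forall>a<k. \<forall>b<k. qinner I (f a) (f b) = (if a = b then 1 else 0))"

lemma qinner_commute: "qinner I g f = qcnj (qinner I f g)"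
  by (simp add: qinner_def qcnj_sum)

lemma qinner_self: "qinner I f f = of_real (\<Sum>i\<in>I. qnormsq (f i))"
  by (simp add: qinner_def qcnj_mult_self)

lemma qinner_scaleR:
  "qinner I f (\<lambda>i. r *\<^sub>R g i) = r *\<^sub>R qinner I f g" "qinner I (\<lambda>i. r *\<^sub>R f i) g = r *\<^sub>R qinner I f g"
  by (simp_all add: qinner_def scaleR_right.sum)

lemma qinner_diff: "qinner I f (\<lambda>i. g i - h i) = qinner I f g - qinner I f h"
  by (simp add: qinner_def right_diff_distrib sum_subtractf)

lemma qinner_combination:
  "qinner I f (\<lambda>i. \<Sum>a\<in>A. g a i * c a) = (\<Sum>a\<in>A. qinner I f (g a) * c a)"
  unfolding qinner_def sum_distrib_left sum_distrib_right
  by (subst sum.swap) (simp add: mult.assoc)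

lemma qinner_combination_orthonormal:
  assumes "qorthonormal I k f" "a < k"
  shows "qinner I (f a) (\<lambda>i. \<Sum>b<k. f b i * c b) = c a"
proof -
  have "qinner I (f a) (\<lambda>i. \<Sum>b<k. f b i * c b) = (\<Sum>b<k. if a = b then c b else 0)"
    unfolding qinner_combination using assms by (intro sum.cong) (auto simp: qorthonormal_def)
  then show ?thesis using assms by simp
qed

text \<open>One Gram-Schmidt step: by \<open>out\<close> the residual of \<open>g\<close> after
  subtracting its projection is nonzero, so it can be normalised. The explicit formula for
  \<open>h\<close> also allows solving for \<open>g\<close>.\<close>

lemma qorthonormal_extend:
  assumes on: "qorthonormal I k f" and "finite I"
    and out: "\<not> (\<forall>i\<in>I. g i = (\<Sum>a<k. f a i * qinner I (f a) g))"
  obtains h r where "r > 0" "qorthonormal I (Suc k) (f(k := h))"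
    "\<And>i. h i = r *\<^sub>R (g i - (\<Sum>a<k. f a i * qinner I (f a) g))"
proof -
  define g' where "g' = (\<lambda>i. g i - (\<Sum>a<k. f a i * qinner I (f a) g))"
  define s where "s = (\<Sum>i\<in>I. qnormsq (g' i))"
  define h where "h = (\<lambda>i. (1 / sqrt s) *\<^sub>R g' i)"
  from out obtain i where i: "i \<in> I" "g' i \<noteq> 0" by (auto simp: g'_def)
  then have "s > 0" unfolding s_def using \<open>finite I\<close>
    by (intro sum_pos2[of I i]) auto
  have orth: "qinner I (f a) g' = 0" if "a < k" for a
    unfolding g'_def qinner_diff using qinner_combination_orthonormal[OF on that] by simp
  have 1: "qinner I (f a) h = 0" if "a < k" for a
    using orth[OF that] by (simp add: h_def qinner_scaleR)
  then have 2: "qinner I h (f a) = 0" if "a < k" for a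
    using that by (simp add: qinner_commute[of I h])
  have "qinner I g' g' = of_real s"
    by (simp add: qinner_self s_def)
  moreover have "(1 / sqrt s) * ((1 / sqrt s) * s) = 1"
    using \<open>s > 0\<close> by (simp add: field_simps)
  ultimately have 3: "qinner I h h = 1"
    unfolding h_def qinner_scaleR by (simp add: of_real_def)
  have "qorthonormal I (Suc k) (f(k := h))"
    using on 1 2 3 by (auto simp: qorthonormal_def less_Suc_eq)
  then show thesis using that[of "1 / sqrt s" h] \<open>s > 0\<close> by (simp add: h_def g'_def)
qed

text \<open>Stands in for dimension theory: \<open>k\<close> is the rank of the family
  \<open>g\<close>. Expanding \<open>g\<close> in \<open>f\<close> bounds the number of generators,
  while expanding \<open>f\<close> in \<open>g\<close> carries linear relations over from
  \<open>g\<close> to \<open>f\<close>.\<close>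

lemma gram_schmidt:
  fixes g :: "nat \<Rightarrow> 'i \<Rightarrow> quat"
  assumes "finite I"
  shows "\<exists>k\<le>m. \<exists>f. qorthonormal I k f \<and>
     (\<forall>l<m. \<exists>c. \<forall>i\<in>I. g l i = (\<Sum>a<k. f a i * c a)) \<and>
     (\<forall>a<k. \<exists>c. \<forall>i\<in>I. f a i = (\<Sum>l<m. g l i * c l))"
proof (induction m)
  case 0
  then show ?case by (auto simp: qorthonormal_def)
next
  case (Suc m)
  then obtain k f where k: "k \<le> m" and on: "qorthonormal I k f"
    and g: "\<And>l. l < m \<Longrightarrow> \<exists>c. \<forall>i\<in>I. g l i = (\<Sum>a<k. f a i * c a)"
    and f: "\<And>a. a < k \<Longrightarrow> \<exists>c. \<forall>i\<in>I. f a i = (\<Sum>l<m. g l i * c l)" by blast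
  have f': "\<exists>c. \<forall>i\<in>I. f a i = (\<Sum>l<Suc m. g l i * c l)" if "a < k" for a
  proof -
    from f[OF that] obtain c where "\<forall>i\<in>I. f a i = (\<Sum>l<m. g l i * c l)" by blast
    then show ?thesis by (intro exI[of _ "c(m := 0)"]) simp
  qed
  show ?case
  proof (cases "\<forall>i\<in>I. g m i = (\<Sum>a<k. f a i * qinner I (f a) (g m))")
    case True
    then have "\<exists>c. \<forall>i\<in>I. g l i = (\<Sum>a<k. f a i * c a)" if "l < Suc m" for l
      using g[of l] that by (cases "l = m") (auto simp: less_Suc_eq)
    then show ?thesis
      using k on f' by (intro exI[of _ k] exI[of _ f] conjI allI impI) auto
  next
    case False
    define e where "e = (\<lambda>a. qinner I (f a) (g m))"
    obtain h r where r: "r > 0" and on': "qorthonormal I (Suc k) (f(k := h))"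
      and h: "\<And>i. h i = r *\<^sub>R (g m i - (\<Sum>a<k. f a i * e a))"
      unfolding e_def using qorthonormal_extend[OF on \<open>finite I\<close> False] by blast
    have 1: "\<exists>c. \<forall>i\<in>I. g l i = (\<Sum>a<Suc k. (f(k := h)) a i * c a)" if l: "l < Suc m" for l
    proof (cases "l = m")
      case True
      then show ?thesis using r
        \<comment> \<open>Solving the formula for \<open>h\<close> for \<open>g m\<close>: the old
          coefficients are those of the projection, the new one is \<open>1/r\<close>.\<close>
        by (intro exI[of _ "e(k := (1/r) *\<^sub>R 1)"]) (simp add: h)
    next
      case False
      then obtain c where "\<forall>i\<in>I. g l i = (\<Sum>a<k. f a i * c a)" using g[of l] l by auto
      then show ?thesis by (intro exI[of _ "c(k := 0)"]) simp
    qed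
    obtain d where d: "\<And>a i. a < k \<Longrightarrow> i \<in> I \<Longrightarrow> f a i = (\<Sum>l<m. g l i * d a l)"
      using f by metis
    \<comment> \<open>The expansions of the old \<open>f a\<close> in the \<open>g l\<close> are
      substituted into the projection of \<open>g m\<close>.\<close>
    have "h i = (\<Sum>l<Suc m. g l i * (if l = m then r *\<^sub>R 1 else - (r *\<^sub>R (\<Sum>a<k. d a l * e a))))"
      if "i \<in> I" for i
    proof -
      have "(\<Sum>a<k. f a i * e a) = (\<Sum>a<k. \<Sum>l<m. g l i * d a l * e a)"
        using d that by (simp add: sum_distrib_right)
      also have "\<dots> = (\<Sum>l<m. g l i * (\<Sum>a<k. d a l * e a))"
        by (subst sum.swap) (simp add: sum_distrib_left mult.assoc)
      finally show ?thesis
        by (simp add: h scaleR_right_diff_distrib scaleR_right.sum sum_negf sum_distrib_left)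
    qed
    then have 2: "\<exists>c. \<forall>i\<in>I. (f(k := h)) a i = (\<Sum>l<Suc m. g l i * c l)" if "a < Suc k" for a
      using f'[of a] that by (cases "a = k") (auto simp: less_Suc_eq simp del: sum.lessThan_Suc)
    have "Suc k \<le> Suc m" using k by simp
    with on' 1 2 show ?thesis by blast
  qed
qed

text \<open>A dimension count by Parseval: if every coordinate indicator \<open>e l\<close> lay in
  the span of \<open>m\<close> orthonormal functions, the values \<open>qnormsq (f' a l)\<close>
  would sum over \<open>a\<close> to 1 for each \<open>l\<close>, and summing over \<open>l\<close>
  would give \<open>card I = m\<close>. So below \<open>card I\<close> some indicator extends the
  family.\<close>

lemma qorthonormal_extend_to:
  fixes f :: "nat \<Rightarrow> 'i \<Rightarrow> quat"
  assumes "finite I" "qorthonormal I k f" "k \<le> m" "m \<le> card I"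
  shows "\<exists>f'. qorthonormal I m f' \<and> (\<forall>a<k. f' a = f a)"
  using assms(3,4)
proof (induction m rule: dec_induct)
  case base
  then show ?case using assms by blast
next
  case (step m)
  then obtain f' where on: "qorthonormal I m f'" and f': "\<forall>a<k. f' a = f a" by auto
  define e :: "'i \<Rightarrow> 'i \<Rightarrow> quat" where "e = (\<lambda>l i. if i = l then 1 else 0)"
  have "\<not> (\<forall>l\<in>I. \<forall>i\<in>I. e l i = (\<Sum>a<m. f' a i * qinner I (f' a) (e l)))"
  proof
    assume *: "\<forall>l\<in>I. \<forall>i\<in>I. e l i = (\<Sum>a<m. f' a i * qinner I (f' a) (e l))"
    have "qinner I (f' a) (e l) = (\<Sum>i\<in>I. if i = l then qcnj (f' a i) else 0)" for a l
      unfolding qinner_def by (rule sum.cong) (auto simp: e_def)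
    then have "qinner I (f' a) (e l) = qcnj (f' a l)" if "l \<in> I" for a l
      using that \<open>finite I\<close> by simp
    then have "of_real 1 = (of_real (\<Sum>a<m. qnormsq (f' a l)) :: quat)" if "l \<in> I" for l
      using *[rule_format, OF that that] that by (simp add: e_def qcnj_mult_self)
    then have "1 = (\<Sum>a<m. qnormsq (f' a l))" if "l \<in> I" for l
      using that by (metis of_real_eq_iff)
    then have "real (card I) = (\<Sum>l\<in>I. \<Sum>a<m. qnormsq (f' a l))" by simp
    also have "\<dots> = (\<Sum>a<m. qre (qinner I (f' a) (f' a)))"
      by (subst sum.swap) (simp only: qinner_self qre_of_real)
    also have "\<dots> = real m" using on by (simp add: qorthonormal_def)
    finally show False using step.prems by simp
  qed
  then obtain l where "l \<in> I" "\<not> (\<forall>i\<in>I. e l i = (\<Sum>a<m. f' a i * qinner I (f' a) (e l)))" by blast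
  with qorthonormal_extend[OF on \<open>finite I\<close>] obtain h where "qorthonormal I (Suc m) (f'(m := h))" by blast
  moreover have "\<forall>a<k. (f'(m := h)) a = f a" using f' step.hyps by simp
  ultimately show ?case by blast
qed


lemma sum_swap3:
  "(\<Sum>j\<in>J. \<Sum>r\<in>A. \<Sum>a\<in>B. g j r a) = (\<Sum>r\<in>A. \<Sum>a\<in>B. \<Sum>j\<in>J. g j r a)"
  by (subst sum.swap, intro sum.cong refl, subst sum.swap) (rule refl)


section \<open>Weighted designs of triples\<close>

text \<open>\<open>b\<close> is the coefficient matrix of the relations, with rows \<open>T\<close>
  and columns \<open>I\<close>; the axioms see only its zero pattern. They describe a weighted
  analogue of a Steiner triple system, each pair of points being covered with total weight
  one.\<close>

locale triple_design =
  fixes I :: "'i set" and T :: "'r set" and w :: "'r \<Rightarrow> real" and b :: "'r \<Rightarrow> 'i \<Rightarrow> quat"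
  assumes finite_I: "finite I" and finite_T: "finite T"
    and w_nonneg: "r \<in> T \<Longrightarrow> w r \<ge> 0"
    and card_supp: "r \<in> T \<Longrightarrow> card {i \<in> I. b r i \<noteq> 0} = 3"
    and pair_weight: "i \<in> I \<Longrightarrow> j \<in> I \<Longrightarrow> i \<noteq> j \<Longrightarrow>
      (\<Sum>r\<in>T. w r * of_bool (b r i \<noteq> 0 \<and> b r j \<noteq> 0)) = 1"
begin

abbreviation "n \<equiv> card I"

text \<open>The total weight per point, which is the average weighted squared column norm once all
  rows have norm one.\<close>

definition mean_weight :: real
  where "mean_weight = (real n - 1) / 6"

text \<open>Double counting over the other points \<open>j\<close>: each triple through
  \<open>i\<close> contains exactly two of them.\<close>

lemma point_weight:
  assumes "i \<in> I"
  shows "(\<Sum>r\<in>T. w r * of_bool (b r i \<noteq> 0)) = 3 * mean_weight"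
proof -
  have c: "(\<Sum>j\<in>I - {i}. of_bool (b r i \<noteq> 0 \<and> b r j \<noteq> 0) :: real) = 2 * of_bool (b r i \<noteq> 0)" if "r \<in> T" for r
  proof (cases "b r i = 0")
    case False
    then have "(I - {i}) \<inter> {j. b r j \<noteq> 0} = {j \<in> I. b r j \<noteq> 0} - {i}" by auto
    moreover have "card ({j \<in> I. b r j \<noteq> 0} - {i}) = 2"
      using False assms card_supp[OF that] by simp
    ultimately have "card ((I - {i}) \<inter> {j. b r j \<noteq> 0}) = 2" by simp
    then show ?thesis using False finite_I by (simp add: sum_of_bool_eq)
  qed simp
  have "real n - 1 = (\<Sum>j\<in>I - {i}. \<Sum>r\<in>T. w r * of_bool (b r i \<noteq> 0 \<and> b r j \<noteq> 0))"
  proof -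
    have "(\<Sum>j\<in>I - {i}. \<Sum>r\<in>T. w r * of_bool (b r i \<noteq> 0 \<and> b r j \<noteq> 0)) = (\<Sum>j\<in>I - {i}. 1)"
      using assms pair_weight by (intro sum.cong) auto
    moreover have "n \<ge> 1"
      using assms finite_I card_gt_0_iff[of I] by fastforce
    ultimately show ?thesis using assms finite_I by (simp add: of_nat_diff)
  qed
  also have "\<dots> = (\<Sum>r\<in>T. w r * (\<Sum>j\<in>I - {i}. of_bool (b r i \<noteq> 0 \<and> b r j \<noteq> 0)))"
    by (subst sum.swap) (simp add: sum_distrib_left)
  also have "\<dots> = (\<Sum>r\<in>T. w r * (2 * of_bool (b r i \<noteq> 0)))"
    using c by (intro sum.cong) auto
  also have "\<dots> = 2 * (\<Sum>r\<in>T. w r * of_bool (b r i \<noteq> 0))"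
    by (simp add: sum_distrib_left mult_ac)
  finally show ?thesis by (simp add: mean_weight_def)
qed

text \<open>Double counting of incidences, as each triple has three points.\<close>

lemma total_weight: "(\<Sum>r\<in>T. w r) = n * mean_weight"
proof -
  have "(\<Sum>i\<in>I. \<Sum>r\<in>T. w r * of_bool (b r i \<noteq> 0)) = (\<Sum>i\<in>I. 3 * mean_weight)"
    by (rule sum.cong) (auto simp: point_weight)
  also have "(\<Sum>i\<in>I. \<Sum>r\<in>T. w r * of_bool (b r i \<noteq> 0)) = (\<Sum>r\<in>T. w r * (\<Sum>i\<in>I. of_bool (b r i \<noteq> 0)))"
    by (subst sum.swap) (simp add: sum_distrib_left)
  also have "\<dots> = (\<Sum>r\<in>T. w r * 3)"
    using card_supp finite_I by (intro sum.cong) (simp_all add: sum_of_bool_eq Int_def)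
  finally show ?thesis by (simp add: sum_distrib_right[symmetric])
qed

section \<open>Scaling of rows and columns by positive reals\<close>

definition row_norm :: "('i \<Rightarrow> real) \<Rightarrow> 'r \<Rightarrow> real"
  where "row_norm p r = (\<Sum>i\<in>I. p i * qnormsq (b r i))"

lemma row_norm_ge:
  assumes "\<And>i. i \<in> I \<Longrightarrow> p i > 0" "i \<in> I"
  shows "p i * qnormsq (b r i) \<le> row_norm p r"
proof -
  have "0 \<le> p j * qnormsq (b r j)" if "j \<in> I" for j
    using assms(1)[OF that] by simp
  then show ?thesis
    unfolding row_norm_def using assms(2) finite_I
    by (intro member_le_sum[where f = "\<lambda>i. p i * qnormsq (b r i)"]) auto
qed

lemma supp_nonempty:
  assumes "r \<in> T"
  obtains i where "i \<in> I" "b r i \<noteq> 0"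
proof -
  have "{i \<in> I. b r i \<noteq> 0} \<noteq> {}" using card_supp[OF assms] by (metis card.empty zero_neq_numeral)
  then show thesis using that by blast
qed

lemma row_norm_pos:
  assumes "\<And>i. i \<in> I \<Longrightarrow> p i > 0" "r \<in> T"
  shows "row_norm p r > 0"
proof -
  obtain i where i: "i \<in> I" "b r i \<noteq> 0" using supp_nonempty[OF assms(2)] .
  then have "0 < p i * qnormsq (b r i)" using assms(1)[OF i(1)] by simp
  also have "\<dots> \<le> row_norm p r" using row_norm_ge assms(1) i by blast
  finally show ?thesis .
qed

text \<open>
  The gradient of this function in the coordinates \<open>ln (p i)\<close> is the column weight minus the
  mean weight, so near-minimisers are nearly balanced.
\<close>

definition potential :: "('i \<Rightarrow> real) \<Rightarrow> real"
  where "potential p = (\<Sum>r\<in>T. w r * ln (row_norm p r)) - mean_weight * (\<Sum>i\<in>I. ln (p i))"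

text \<open>\<open>row_norm p r\<close> dominates each of its three nonzero terms, hence their
  geometric mean. After weighting, each \<open>ln (p i)\<close> has total coefficient
  \<open>mean_weight\<close> by \<open>point_weight\<close>, so the parts depending on
  \<open>p\<close> cancel and \<open>B\<close> remains.\<close>

lemma potential_bounded_below: "\<exists>B. \<forall>p. (\<forall>i\<in>I. p i > 0) \<longrightarrow> B \<le> potential p"
proof -
  define B where "B = (\<Sum>r\<in>T. w r * ((\<Sum>i\<in>I. of_bool (b r i \<noteq> 0) * ln (qnormsq (b r i))) / 3))"
  have "B \<le> potential p" if p: "\<forall>i\<in>I. p i > 0" for p :: "'i \<Rightarrow> real"
  proof -
  have "(\<Sum>i\<in>I. of_bool (b r i \<noteq> 0) * (ln (qnormsq (b r i)) + ln (p i))) \<le> 3 * ln (row_norm p r)" if r: "r \<in> T" for r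
  proof -
    have "(\<Sum>i\<in>I. of_bool (b r i \<noteq> 0) * (ln (qnormsq (b r i)) + ln (p i)))
      \<le> (\<Sum>i\<in>I. of_bool (b r i \<noteq> 0) * ln (row_norm p r))"
    proof (rule sum_mono)
      fix i assume i: "i \<in> I"
      have "ln (qnormsq (b r i)) + ln (p i) \<le> ln (row_norm p r)" if "b r i \<noteq> 0"
      proof -
        have "ln (qnormsq (b r i)) + ln (p i) = ln (p i * qnormsq (b r i))"
          using bspec[OF p i] that by (simp add: ln_mult)
        also have "\<dots> \<le> ln (row_norm p r)"
          using row_norm_ge[of p i r] p i that row_norm_pos[OF _ r, of p] by (subst ln_le_cancel_iff) auto
        finally show ?thesis .
      qed
      then show "of_bool (b r i \<noteq> 0) * (ln (qnormsq (b r i)) + ln (p i)) \<le> of_bool (b r i \<noteq> 0) * ln (row_norm p r)"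
        by simp
    qed
    also have "\<dots> = 3 * ln (row_norm p r)"
      using card_supp[OF r] finite_I by (simp add: sum_distrib_right[symmetric] sum_of_bool_eq Int_def)
    finally show ?thesis .
  qed
  then have "(\<Sum>i\<in>I. of_bool (b r i \<noteq> 0) * (ln (qnormsq (b r i)) + ln (p i))) / 3 \<le> ln (row_norm p r)"
    if "r \<in> T" for r
    using that by fastforce
  with w_nonneg have "(\<Sum>r\<in>T. w r * ((\<Sum>i\<in>I. of_bool (b r i \<noteq> 0) * (ln (qnormsq (b r i)) + ln (p i))) / 3))
    \<le> (\<Sum>r\<in>T. w r * ln (row_norm p r))"
    by (intro sum_mono mult_left_mono)
  moreover have "(\<Sum>r\<in>T. w r * ((\<Sum>i\<in>I. of_bool (b r i \<noteq> 0) * (ln (qnormsq (b r i)) + ln (p i))) / 3))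
    = B + (\<Sum>r\<in>T. w r * ((\<Sum>i\<in>I. of_bool (b r i \<noteq> 0) * ln (p i)) / 3))"
    unfolding B_def sum.distrib[symmetric] by (rule sum.cong) (simp_all add: sum.distrib ring_distribs add_divide_distrib)
  moreover have "(\<Sum>r\<in>T. w r * ((\<Sum>i\<in>I. of_bool (b r i \<noteq> 0) * ln (p i)) / 3)) = mean_weight * (\<Sum>i\<in>I. ln (p i))"
  proof -
    have "(\<Sum>r\<in>T. w r * ((\<Sum>i\<in>I. of_bool (b r i \<noteq> 0) * ln (p i)) / 3))
      = (\<Sum>i\<in>I. \<Sum>r\<in>T. w r * of_bool (b r i \<noteq> 0) * (ln (p i) / 3))"
      unfolding sum_divide_distrib sum_distrib_left by (subst sum.swap) (simp add: mult.assoc)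
    also have "\<dots> = (\<Sum>i\<in>I. 3 * mean_weight * (ln (p i) / 3))"
      unfolding sum_distrib_right[symmetric] by (rule sum.cong) (auto simp: point_weight)
    finally show ?thesis by (simp add: sum_distrib_left)
  qed
  ultimately show ?thesis unfolding potential_def by linarith
  qed
  then show ?thesis by blast
qed

text \<open>The weighted squared norm of column \<open>i\<close> after every column \<open>j\<close>
  is multiplied by \<open>sqrt (p j)\<close> and the rows are then normalised.\<close>

definition column_weight :: "('i \<Rightarrow> real) \<Rightarrow> 'i \<Rightarrow> real"
  where "column_weight p i = (\<Sum>r\<in>T. w r * (p i * qnormsq (b r i) / row_norm p r))"

text \<open>A finite-difference form of the gradient: by ln x \<le> x - 1 the first sum grows by at
  most \<open>\<eta> * column_weight p i\<close>, while the subtracted term grows by exactly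
  \<open>mean_weight * ln (1 + \<eta>)\<close>.\<close>

lemma potential_update_le:
  assumes p: "\<And>j. j \<in> I \<Longrightarrow> p j > 0" and i: "i \<in> I" and "\<eta> > 0"
  shows "potential (p(i := (1 + \<eta>) * p i)) \<le> potential p + \<eta> * column_weight p i - mean_weight * ln (1 + \<eta>)"
proof -
  define p' where "p' = p(i := (1 + \<eta>) * p i)"
  have p': "p' j > 0" if "j \<in> I" for j
    using p[OF that] p[OF i] \<open>\<eta> > 0\<close> by (simp add: p'_def)
  have row: "row_norm p' r = row_norm p r + \<eta> * (p i * qnormsq (b r i))" for r
  proof -
    have "row_norm p' r = (\<Sum>j\<in>I. p j * qnormsq (b r j) + (if j = i then \<eta> * (p i * qnormsq (b r i)) else 0))"
      unfolding row_norm_def by (rule sum.cong) (auto simp: p'_def algebra_simps)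
    then show ?thesis using i finite_I by (simp add: sum.distrib row_norm_def)
  qed
  have ln_row: "ln (row_norm p' r) \<le> ln (row_norm p r) + \<eta> * (p i * qnormsq (b r i) / row_norm p r)" if "r \<in> T" for r
  proof -
    have *: "row_norm p r > 0" "row_norm p' r > 0" using row_norm_pos p p' that by auto
    then have "ln (row_norm p' r) - ln (row_norm p r) = ln (row_norm p' r / row_norm p r)"
      by (simp add: ln_div)
    also have "\<dots> \<le> row_norm p' r / row_norm p r - 1"
      using * by (intro ln_le_minus_one) simp
    also have "\<dots> = \<eta> * (p i * qnormsq (b r i) / row_norm p r)"
      using * by (simp add: row field_simps)
    finally show ?thesis by simp
  qed
  have "(\<Sum>r\<in>T. w r * ln (row_norm p' r))
    \<le> (\<Sum>r\<in>T. w r * (ln (row_norm p r) + \<eta> * (p i * qnormsq (b r i) / row_norm p r)))"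
    by (intro sum_mono mult_left_mono ln_row w_nonneg)
  also have "\<dots> = (\<Sum>r\<in>T. w r * ln (row_norm p r)) + \<eta> * column_weight p i"
    by (simp add: column_weight_def ring_distribs sum.distrib sum_distrib_left mult_ac)
  finally have 1: "(\<Sum>r\<in>T. w r * ln (row_norm p' r)) \<le> (\<Sum>r\<in>T. w r * ln (row_norm p r)) + \<eta> * column_weight p i" .
  have "(\<Sum>j\<in>I. ln (p' j)) = (\<Sum>j\<in>I. ln (p j) + (if j = i then ln (1 + \<eta>) else 0))"
    using p p[OF i] \<open>\<eta> > 0\<close> by (intro sum.cong) (auto simp: p'_def ln_mult)
  then have "(\<Sum>j\<in>I. ln (p' j)) = (\<Sum>j\<in>I. ln (p j)) + ln (1 + \<eta>)"
    using i finite_I by (simp add: sum.distrib)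
  with 1 show ?thesis unfolding potential_def p'_def[symmetric] by (simp add: ring_distribs)
qed

lemma column_weight_nonneg:
  assumes "\<And>j. j \<in> I \<Longrightarrow> p j > 0" "i \<in> I"
  shows "column_weight p i \<ge> 0"
  unfolding column_weight_def
  by (intro sum_nonneg mult_nonneg_nonneg divide_nonneg_nonneg w_nonneg)
     (use assms row_norm_pos[of p] in \<open>auto intro: less_imp_le\<close>)

text \<open>The infimum of the potential might not be attained, so a near-minimiser is taken. If a
  column were too light, enlarging its \<open>p i\<close> by the factor \<open>1 + \<eta>\<close>
  would push the potential below the infimum.\<close>

lemma scaling:
  assumes "\<epsilon> > 0"
  obtains p where "\<And>i. i \<in> I \<Longrightarrow> p i > 0" "\<And>i. i \<in> I \<Longrightarrow> column_weight p i \<ge> mean_weight - \<epsilon>"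
proof (cases "mean_weight \<le> \<epsilon>")
  case True
  show thesis
    by (rule that[of "\<lambda>_. 1"]) (use True column_weight_nonneg[of "\<lambda>_. 1"] in fastforce)+
next
  case False
  \<comment> \<open>This makes the second-order loss \<open>mean_weight * \<eta>\<^sup>2\<close>
    half of the first-order gain \<open>\<epsilon> * \<eta>\<close>, for a net decrease of
    \<open>\<epsilon> / 2 * \<eta>\<close>.\<close>
  define \<eta> where "\<eta> = \<epsilon> / (2 * mean_weight)"
  have \<eta>: "0 < \<eta>" "\<eta> \<le> 1" "mean_weight * \<eta> = \<epsilon> / 2"
    using False assms by (auto simp: \<eta>_def field_simps)
  define V where "V = potential ` {p. \<forall>i\<in>I. p i > 0}"
  have "bdd_below V" "V \<noteq> {}"
    using potential_bounded_below by (auto simp: V_def bdd_below_def intro!: exI[of _ "\<lambda>_. 1"])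
  moreover have "Inf V < Inf V + \<epsilon> / 2 * \<eta>" using assms \<eta> by simp
  ultimately obtain y where "y \<in> V" "y < Inf V + \<epsilon> / 2 * \<eta>"
    using cInf_less_iff[of V] by blast
  then obtain p where p: "\<forall>i\<in>I. p i > 0" "potential p < Inf V + \<epsilon> / 2 * \<eta>"
    unfolding V_def by blast
  show thesis
  proof (rule that[of p])
    fix i assume i: "i \<in> I"
    show "p i > 0" using p i by blast
    show "column_weight p i \<ge> mean_weight - \<epsilon>"
    proof (rule ccontr)
      assume "\<not> ?thesis"
      then have small: "\<eta> * column_weight p i \<le> \<eta> * (mean_weight - \<epsilon>)"
        using \<eta> by (intro mult_left_mono) auto
      have "Inf V \<le> potential (p(i := (1 + \<eta>) * p i))"
        using \<open>bdd_below V\<close> p i \<eta> by (intro cInf_lower) (auto simp: V_def)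
      also have "\<dots> \<le> potential p + \<eta> * column_weight p i - mean_weight * ln (1 + \<eta>)"
        using potential_update_le p i \<eta> by blast
      also have "mean_weight * ln (1 + \<eta>) \<ge> mean_weight * (\<eta> - \<eta>\<^sup>2)"
        using ln_one_plus_pos_lower_bound[of \<eta>] \<eta> False assms by (intro mult_left_mono) auto
      then have "potential p + \<eta> * column_weight p i - mean_weight * ln (1 + \<eta>)
        \<le> potential p + \<eta> * (mean_weight - \<epsilon>) - mean_weight * (\<eta> - \<eta>\<^sup>2)"
        using small by linarith
      also have "\<dots> = potential p - \<epsilon> / 2 * \<eta>"
        using \<eta>(3) by (simp add: algebra_simps power2_eq_square)
      finally show False using p(2) by simp
    qed
  qed
qed

section \<open>Trace estimate for the Gram matrix\<close>

text \<open>
  Summing the squared norms of the relations over an orthonormal family pairs the Gram matrix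
  \<open>M\<close> of the columns with the projection matrix \<open>P\<close>.  If the columns are balanced up to
  \<open>\<epsilon>\<close>, then Young's inequality with the weight \<open>3 / n\<close> leads to \<open>1 \<le> 4 * \<epsilon>\<close>, which
  \<open>\<epsilon> = 1/5\<close> violates.
\<close>

lemma balanced_orthonormal_contradiction:
  assumes unit: "\<And>r. r \<in> T \<Longrightarrow> (\<Sum>i\<in>I. qnormsq (b r i)) = 1"
    and balanced: "\<And>i. i \<in> I \<Longrightarrow> (\<Sum>r\<in>T. w r * qnormsq (b r i)) \<ge> mean_weight - 1/5"
    and on: "qorthonormal I 4 f"
    and rel: "\<And>r a. r \<in> T \<Longrightarrow> a < 4 \<Longrightarrow> (\<Sum>i\<in>I. b r i * f a i) = 0"
  shows False
proof -
  \<comment> \<open>\<open>P i j\<close> is entry (j, i) of the projection onto the span of the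
    \<open>f a\<close>, and \<open>M\<close> is the weighted Gram matrix of the columns. With these
    index orders the entrywise pairing is the real part of the trace of a matrix product.\<close>
  define P where "P = (\<lambda>i j. \<Sum>a<4. f a j * qcnj (f a i))"
  define M where "M = (\<lambda>i j. \<Sum>r\<in>T. w r *\<^sub>R (qcnj (b r i) * b r j))"
  define p where "p = (\<lambda>i. \<Sum>a<4. qnormsq (f a i))"
  define G where "G = (\<lambda>i. \<Sum>r\<in>T. w r * qnormsq (b r i))"
  have p_nonneg: "p i \<ge> 0" for i by (simp add: p_def sum_nonneg)
  have sum_p: "(\<Sum>i\<in>I. p i) = 4"
  proof -
    have "(\<Sum>i\<in>I. p i) = (\<Sum>a<4. qre (qinner I (f a) (f a)))"
      unfolding p_def by (subst sum.swap) (simp only: qinner_self qre_of_real)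
    then show ?thesis using on by (simp add: qorthonormal_def)
  qed
  have P_diag: "P i i = of_real (p i)" for i
    by (simp add: P_def p_def qcnj_mult_self)
  have M_diag: "M i i = of_real (G i)" for i
    unfolding M_def G_def qcnj_mult_self by (simp add: of_real_def scaleR_left.sum)
  have MP_diag: "qre (M i i * P i i) = G i * p i" for i
    unfolding M_diag P_diag of_real_quat by (simp add: times_quat_def)
  \<comment> \<open>Real parts are invariant under cyclic shifts, so \<open>qcnj (f a i)\<close> can
    be moved next to \<open>qcnj (b r i)\<close>; the inner sum over \<open>j\<close> then vanishes
    by \<open>rel\<close>.\<close>
  have total: "(\<Sum>i\<in>I. \<Sum>j\<in>I. qre (M i j * P i j)) = 0"
  proof -
    have "qre (M i j * P i j) = (\<Sum>r\<in>T. \<Sum>a<4. w r * qre (qcnj (b r i * f a i) * (b r j * f a j)))" for i j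
    proof -
      have "qre (M i j * P i j) = (\<Sum>r\<in>T. \<Sum>a<4. w r * qre (qcnj (b r i) * b r j * (f a j * qcnj (f a i))))"
        by (simp add: M_def P_def sum_product quat_sel_sum)
      moreover have "qre (qcnj (b r i) * b r j * (f a j * qcnj (f a i))) = qre (qcnj (b r i * f a i) * (b r j * f a j))" for r a
        using qre_mult_commute[of "qcnj (b r i) * b r j * f a j" "qcnj (f a i)"] by (simp add: mult.assoc)
      ultimately show ?thesis by simp
    qed
    note eq = this
    have "(\<Sum>i\<in>I. \<Sum>j\<in>I. qre (M i j * P i j))
      = (\<Sum>i\<in>I. \<Sum>r\<in>T. \<Sum>a<4. \<Sum>j\<in>I. w r * qre (qcnj (b r i * f a i) * (b r j * f a j)))"
      unfolding eq by (rule sum.cong[OF refl]) (rule sum_swap3)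
    also have "\<dots> = (\<Sum>i\<in>I. \<Sum>r\<in>T. \<Sum>a<4. w r * qre (qcnj (b r i * f a i) * (\<Sum>j\<in>I. b r j * f a j)))"
      by (simp add: sum_distrib_left quat_sel_sum)
    also have "\<dots> = 0"
      by (intro sum.neutral ballI) (simp add: rel)
    finally show ?thesis .
  qed
  \<comment> \<open>The squared Frobenius norm of a projection is its trace, here 4; orthonormality
    collapses the double sum over \<open>a\<close> and \<open>c\<close>.\<close>
  have P_sum: "(\<Sum>i\<in>I. \<Sum>j\<in>I. qnormsq (P i j)) = 4"
  proof -
    have "qnormsq (P i j) = (\<Sum>a<4. \<Sum>c<4. qre (qcnj (f c j) * f a j * (qcnj (f a i) * f c i)))" for i j
    proof -
      have "qnormsq (P i j) = qre (P i j * qcnj (P i j))"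
        by (simp add: qcnj_mult_self)
      also have "\<dots> = (\<Sum>a<4. \<Sum>c<4. qre ((f a j * qcnj (f a i)) * (f c i * qcnj (f c j))))"
        unfolding P_def qcnj_sum sum_product quat_sel_sum by simp
      also have "\<dots> = (\<Sum>a<4. \<Sum>c<4. qre (qcnj (f c j) * f a j * (qcnj (f a i) * f c i)))"
      proof (intro sum.cong refl)
        fix a c
        show "qre ((f a j * qcnj (f a i)) * (f c i * qcnj (f c j))) = qre (qcnj (f c j) * f a j * (qcnj (f a i) * f c i))"
          using qre_mult_commute[of "f a j * qcnj (f a i) * f c i" "qcnj (f c j)"] by (simp add: mult.assoc)
      qed
      finally show ?thesis .
    qed
    note eq = this
    have "(\<Sum>i\<in>I. \<Sum>j\<in>I. qnormsq (P i j))
      = (\<Sum>i\<in>I. \<Sum>a<4. \<Sum>c<4. \<Sum>j\<in>I. qre (qcnj (f c j) * f a j * (qcnj (f a i) * f c i)))"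
      unfolding eq by (rule sum.cong[OF refl]) (rule sum_swap3)
    also have "\<dots> = (\<Sum>i\<in>I. \<Sum>a<4. \<Sum>c<4. qre (qinner I (f c) (f a) * (qcnj (f a i) * f c i)))"
      by (simp add: qinner_def sum_distrib_right quat_sel_sum)
    also have "\<dots> = (\<Sum>i\<in>I. \<Sum>a<4. \<Sum>c<4. if c = a then qnormsq (f a i) else 0)"
      using on by (intro sum.cong) (auto simp: qorthonormal_def qcnj_mult_self)
    also have "\<dots> = (\<Sum>i\<in>I. p i)" by (simp add: p_def)
    finally show ?thesis using sum_p by simp
  qed
  have split: "(\<Sum>i\<in>I. \<Sum>j\<in>I. X i j) = (\<Sum>i\<in>I. X i i) + (\<Sum>i\<in>I. \<Sum>j\<in>I - {i}. X i j)" for X :: "'i \<Rightarrow> 'i \<Rightarrow> real"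
    unfolding sum.distrib[symmetric] by (intro sum.cong refl sum.remove finite_I)
  have "I \<noteq> {}" using sum_p by auto
  then have n: "real n > 0" using finite_I by (simp add: card_gt_0_iff)
  \<comment> \<open>Cauchy-Schwarz: the diagonal entries sum to 4, so their squares have least sum
    when all equal \<open>4 / n\<close>.\<close>
  have P_diag_sum: "(\<Sum>i\<in>I. (p i)\<^sup>2) \<ge> 16 / n"
  proof -
    have "0 \<le> (\<Sum>i\<in>I. (p i - 4 / n)\<^sup>2)" by (intro sum_nonneg) auto
    also have "\<dots> = (\<Sum>i\<in>I. (p i)\<^sup>2 - 8 / n * p i + 16 / n\<^sup>2)"
      by (intro sum.cong) (auto simp: power2_diff power_divide)
    also have "\<dots> = (\<Sum>i\<in>I. (p i)\<^sup>2) - 8 / n * 4 + n * (16 / n\<^sup>2)"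
      unfolding sum.distrib sum_subtractf sum_distrib_left[symmetric] sum_p by simp
    also have "\<dots> = (\<Sum>i\<in>I. (p i)\<^sup>2) - 16 / n"
      using n by (simp add: power2_eq_square field_simps)
    finally show ?thesis by simp
  qed
  have P_off: "(\<Sum>i\<in>I. \<Sum>j\<in>I - {i}. qnormsq (P i j)) \<le> 4 - 16 / n"
  proof -
    have "qnormsq (P i i) = (p i)\<^sup>2" for i
      by (simp add: P_diag qnormsq_def of_real_quat)
    then show ?thesis using split[of "\<lambda>i j. qnormsq (P i j)"] P_sum P_diag_sum by simp
  qed
  have M_off: "(\<Sum>i\<in>I. \<Sum>j\<in>I - {i}. qnormsq (M i j)) \<le> 2 / 3 * (n * mean_weight)"
  proof -
    have "qnormsq (M i j) \<le> (\<Sum>r\<in>T. w r * (qnormsq (b r i) * qnormsq (b r j)))"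
      if "i \<in> I" "j \<in> I - {i}" for i j
    proof -
      \<comment> \<open>By \<open>pair_weight\<close> these weights sum to one, so Jensen applies;
        the indicator changes no term because the products vanish where it is 0.\<close>
      define u where "u = (\<lambda>r. w r * of_bool (b r i \<noteq> 0 \<and> b r j \<noteq> 0))"
      have "M i j = (\<Sum>r\<in>T. u r *\<^sub>R (qcnj (b r i) * b r j))"
        unfolding M_def u_def by (rule sum.cong) auto
      also have "qnormsq \<dots> \<le> (\<Sum>r\<in>T. u r * qnormsq (qcnj (b r i) * b r j))"
        using that pair_weight[of i j] w_nonneg by (intro qnormsq_weighted_sum_le) (auto simp: u_def)
      also have "\<dots> = (\<Sum>r\<in>T. w r * (qnormsq (b r i) * qnormsq (b r j)))"
        by (rule sum.cong) (auto simp: u_def qnormsq_mult)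
      finally show ?thesis .
    qed
    then have "(\<Sum>i\<in>I. \<Sum>j\<in>I - {i}. qnormsq (M i j))
      \<le> (\<Sum>i\<in>I. \<Sum>j\<in>I - {i}. \<Sum>r\<in>T. w r * (qnormsq (b r i) * qnormsq (b r j)))"
      by (intro sum_mono)
    also have "\<dots> = (\<Sum>i\<in>I. \<Sum>j\<in>I. \<Sum>r\<in>T. w r * (qnormsq (b r i) * qnormsq (b r j)))
        - (\<Sum>i\<in>I. \<Sum>r\<in>T. w r * (qnormsq (b r i))\<^sup>2)"
      by (simp add: split[of "\<lambda>i j. \<Sum>r\<in>T. w r * (qnormsq (b r i) * qnormsq (b r j))"] power2_eq_square)
    also have "\<dots> = (\<Sum>r\<in>T. w r * ((\<Sum>i\<in>I. qnormsq (b r i)) * (\<Sum>j\<in>I. qnormsq (b r j))))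
        - (\<Sum>r\<in>T. w r * (\<Sum>i\<in>I. (qnormsq (b r i))\<^sup>2))"
    proof (intro arg_cong2[where f = "(-)"])
      show "(\<Sum>i\<in>I. \<Sum>j\<in>I. \<Sum>r\<in>T. w r * (qnormsq (b r i) * qnormsq (b r j)))
        = (\<Sum>r\<in>T. w r * ((\<Sum>i\<in>I. qnormsq (b r i)) * (\<Sum>j\<in>I. qnormsq (b r j))))"
        unfolding sum_product unfolding sum_distrib_left by (rule sum_swap3[symmetric])
      show "(\<Sum>i\<in>I. \<Sum>r\<in>T. w r * (qnormsq (b r i))\<^sup>2) = (\<Sum>r\<in>T. w r * (\<Sum>i\<in>I. (qnormsq (b r i))\<^sup>2))"
        unfolding sum_distrib_left by (rule sum.swap)
    qed
    also have "\<dots> = (\<Sum>r\<in>T. w r * (1 - (\<Sum>i\<in>I. (qnormsq (b r i))\<^sup>2)))"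
      by (simp add: unit sum_subtractf right_diff_distrib)
    \<comment> \<open>Three numbers with sum 1 have squares summing to at least 1/3.\<close>
    also have "\<dots> \<le> (\<Sum>r\<in>T. w r * (2 / 3))"
    proof (intro sum_mono mult_left_mono w_nonneg)
      fix r assume r: "r \<in> T"
      define A where "A = {i \<in> I. b r i \<noteq> 0}"
      have A: "A \<subseteq> I" "card A = 3" using card_supp[OF r] by (auto simp: A_def)
      have s1: "(\<Sum>i\<in>A. qnormsq (b r i)) = 1"
        unfolding unit[OF r, symmetric] using finite_I by (intro sum.mono_neutral_left) (auto simp: A_def)
      have s2: "(\<Sum>i\<in>A. (qnormsq (b r i))\<^sup>2) = (\<Sum>i\<in>I. (qnormsq (b r i))\<^sup>2)"
        using finite_I by (intro sum.mono_neutral_left) (auto simp: A_def)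
      have "0 \<le> (\<Sum>i\<in>A. (qnormsq (b r i) - 1 / 3)\<^sup>2)" by (intro sum_nonneg) auto
      also have "\<dots> = (\<Sum>i\<in>A. (qnormsq (b r i))\<^sup>2 - 2 / 3 * qnormsq (b r i) + 1 / 9)"
        by (intro sum.cong) (auto simp: power2_diff power_divide)
      also have "\<dots> = (\<Sum>i\<in>A. (qnormsq (b r i))\<^sup>2) - 1 / 3"
        unfolding sum.distrib sum_subtractf sum_distrib_left[symmetric] s1 using A by simp
      finally show "1 - (\<Sum>i\<in>I. (qnormsq (b r i))\<^sup>2) \<le> 2 / 3" using s2 by simp
    qed
    also have "\<dots> = 2 / 3 * (n * mean_weight)"
      unfolding sum_distrib_right[symmetric] total_weight by simp
    finally show ?thesis .
  qed
  define R where "R = (\<Sum>i\<in>I. \<Sum>j\<in>I - {i}. qre (M i j * P i j))"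
  define SM where "SM = (\<Sum>i\<in>I. \<Sum>j\<in>I - {i}. qnormsq (M i j))"
  define SP where "SP = (\<Sum>i\<in>I. \<Sum>j\<in>I - {i}. qnormsq (P i j))"
  have diag: "(\<Sum>i\<in>I. G i * p i) \<ge> (mean_weight - 1 / 5) * 4"
    unfolding sum_p[symmetric] sum_distrib_left
    using balanced p_nonneg unfolding G_def by (intro sum_mono mult_right_mono)
  \<comment> \<open>The parameter \<open>3 / n\<close> is optimal to leading order: the bounds on
    \<open>SM\<close> and \<open>SP\<close> are about n^2 / 9 and 4, and Young's inequality is best
    at the square root of \<open>SP / (4 * SM)\<close>.\<close>
  have "(\<Sum>i\<in>I. \<Sum>j\<in>I - {i}. - (3 / n * qnormsq (M i j)) - qnormsq (P i j) / (4 * (3 / n))) \<le> R"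
    unfolding R_def using n by (intro sum_mono qre_mult_ge) simp
  also have "(\<Sum>i\<in>I. \<Sum>j\<in>I - {i}. - (3 / n * qnormsq (M i j)) - qnormsq (P i j) / (4 * (3 / n)))
    = - (3 / n * SM) - SP / (4 * (3 / n))"
    unfolding SM_def SP_def sum_subtractf sum_negf sum_distrib_left sum_divide_distrib ..
  finally have off: "- (3 / n * SM) - SP / (4 * (3 / n)) \<le> R" .
  have "3 / n * SM \<le> 3 / n * (2 / 3 * (n * mean_weight))"
    unfolding SM_def by (intro mult_left_mono M_off) simp
  also have "\<dots> = 2 * mean_weight"
    using n by simp
  finally have M: "3 / n * SM \<le> 2 * mean_weight" .
  have "SP / (4 * (3 / n)) \<le> (4 - 16 / n) / (4 * (3 / n))"
    unfolding SP_def by (intro divide_right_mono P_off) simp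
  also have "\<dots> = n / 3 - 4 / 3"
    using n by (simp add: field_simps)
  finally have P: "SP / (4 * (3 / n)) \<le> n / 3 - 4 / 3" .
  have "(\<Sum>i\<in>I. G i * p i) + R = 0"
    using total unfolding split[of "\<lambda>i j. qre (M i j * P i j)"] MP_diag R_def .
  with diag off M P have "(mean_weight - 1 / 5) * 4 - 2 * mean_weight - (n / 3 - 4 / 3) \<le> 0"
    by linarith
  \<comment> \<open>The terms linear in \<open>n\<close> cancel, leaving the constant 1 - 4/5 on the
    left.\<close>
  then show False by (simp add: mean_weight_def field_simps)
qed

text \<open>Multiplying \<open>b\<close> and dividing \<open>g\<close> by \<open>sqrt (p i)\<close>
  preserves the relations. If the rank \<open>k\<close> of the rescaled family exceeded 3, its first
  four orthonormal functions would satisfy all relations of a balanced design, against the trace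
  estimate. Undoing the division carries the expansions back to \<open>g\<close>.\<close>

lemma dimension_le_3:
  fixes g :: "nat \<Rightarrow> 'i \<Rightarrow> quat"
  assumes rel: "\<And>r l. r \<in> T \<Longrightarrow> l < m \<Longrightarrow> (\<Sum>i\<in>I. b r i * g l i) = 0"
  shows "\<exists>k\<le>3. \<exists>f :: nat \<Rightarrow> 'i \<Rightarrow> quat. \<forall>l<m. \<exists>c. \<forall>i\<in>I. g l i = (\<Sum>a<k. f a i * c a)"
proof -
  obtain p where p: "\<And>i. i \<in> I \<Longrightarrow> p i > 0"
    and col: "\<And>i. i \<in> I \<Longrightarrow> column_weight p i \<ge> mean_weight - 1 / 5"
    using scaling[of "1 / 5"] by auto
  define g' where "g' = (\<lambda>l i. (1 / sqrt (p i)) *\<^sub>R g l i)"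
  obtain k f where on: "qorthonormal I k f"
    and g': "\<And>l. l < m \<Longrightarrow> \<exists>c. \<forall>i\<in>I. g' l i = (\<Sum>a<k. f a i * c a)"
    and f: "\<And>a. a < k \<Longrightarrow> \<exists>c. \<forall>i\<in>I. f a i = (\<Sum>l<m. g' l i * c l)"
    using gram_schmidt[OF finite_I, of m g'] by blast
  have "k \<le> 3"
  proof (rule ccontr)
    assume k: "\<not> k \<le> 3"
    define b' where "b' = (\<lambda>r i. (sqrt (p i) / sqrt (row_norm p r)) *\<^sub>R b r i)"
    have b'_0: "b' r i = 0 \<longleftrightarrow> b r i = 0" if "r \<in> T" "i \<in> I" for r i
      using p[OF that(2)] row_norm_pos[of p, OF p that(1)] by (simp add: b'_def)
    have b'_norm: "qnormsq (b' r i) = p i * qnormsq (b r i) / row_norm p r" if "r \<in> T" "i \<in> I" for r i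
      using p[OF that(2)] row_norm_pos[of p, OF p that(1)]
      by (simp add: b'_def qnormsq_scaleR power_divide)
    \<comment> \<open>Positive real factors keep the zero pattern, so the same weights again give a
      design.\<close>
    interpret scaled: triple_design I T w b'
    proof
      show "card {i \<in> I. b' r i \<noteq> 0} = 3" if "r \<in> T" for r
      proof -
        have "{i \<in> I. b' r i \<noteq> 0} = {i \<in> I. b r i \<noteq> 0}" using b'_0[OF that] by blast
        then show ?thesis using card_supp[OF that] by simp
      qed
      show "(\<Sum>r\<in>T. w r * of_bool (b' r i \<noteq> 0 \<and> b' r j \<noteq> 0)) = 1" if "i \<in> I" "j \<in> I" "i \<noteq> j" for i j
      proof -
        have "(\<Sum>r\<in>T. w r * of_bool (b' r i \<noteq> 0 \<and> b' r j \<noteq> 0))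
          = (\<Sum>r\<in>T. w r * of_bool (b r i \<noteq> 0 \<and> b r j \<noteq> 0))"
          by (rule sum.cong) (simp_all add: b'_0 that)
        then show ?thesis using pair_weight[OF that] by simp
      qed
    qed (fact finite_I finite_T w_nonneg)+
    show False
    proof (rule scaled.balanced_orthonormal_contradiction)
      show "(\<Sum>i\<in>I. qnormsq (b' r i)) = 1" if "r \<in> T" for r
      proof -
        have "(\<Sum>i\<in>I. qnormsq (b' r i)) = row_norm p r / row_norm p r"
          unfolding row_norm_def[of p r] sum_divide_distrib
          by (rule sum.cong) (simp_all add: b'_norm[OF that] row_norm_def)
        then show ?thesis using row_norm_pos[of p, OF p that] by simp
      qed
      show "scaled.mean_weight - 1 / 5 \<le> (\<Sum>r\<in>T. w r * qnormsq (b' r i))" if "i \<in> I" for i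
      proof -
        have "(\<Sum>r\<in>T. w r * qnormsq (b' r i)) = column_weight p i"
          unfolding column_weight_def by (rule sum.cong) (simp_all add: b'_norm that)
        then show ?thesis
          using col[OF that] by (simp add: mean_weight_def scaled.mean_weight_def)
      qed
      show "qorthonormal I 4 f" using on k by (simp add: qorthonormal_def)
      show "(\<Sum>i\<in>I. b' r i * f a i) = 0" if r: "r \<in> T" and a: "a < 4" for r a
      proof -
        have "a < k" using k a by simp
        then obtain c where "\<forall>i\<in>I. f a i = (\<Sum>l<m. g' l i * c l)" using f by blast
        then have "(\<Sum>i\<in>I. b' r i * f a i) = (\<Sum>i\<in>I. \<Sum>l<m. b' r i * g' l i * c l)"
          by (simp add: sum_distrib_left mult.assoc)
        also have "\<dots> = (\<Sum>l<m. (\<Sum>i\<in>I. b' r i * g' l i) * c l)"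
          by (subst sum.swap) (simp add: sum_distrib_right)
        also have "\<dots> = (\<Sum>l<m. ((1 / sqrt (row_norm p r)) *\<^sub>R (\<Sum>i\<in>I. b r i * g l i)) * c l)"
        proof -
          have "b' r i * g' l i = (1 / sqrt (row_norm p r)) *\<^sub>R (b r i * g l i)" if "i \<in> I" for i l
            using p[OF that] by (simp add: b'_def g'_def)
          then have "(\<Sum>i\<in>I. b' r i * g' l i) = (\<Sum>i\<in>I. (1 / sqrt (row_norm p r)) *\<^sub>R (b r i * g l i))" for l
            by (intro sum.cong refl)
          then show ?thesis by (simp only: scaleR_right.sum)
        qed
        also have "\<dots> = 0" by (simp add: rel[OF r])
        finally show ?thesis .
      qed
    qed
  qed
  moreover have "\<exists>c. \<forall>i\<in>I. g l i = (\<Sum>a<k. (sqrt (p i) *\<^sub>R f a i) * c a)" if l: "l < m" for l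
  proof -
    obtain c where c: "\<forall>i\<in>I. g' l i = (\<Sum>a<k. f a i * c a)" using g'[OF l] by blast
    have "g l i = (\<Sum>a<k. (sqrt (p i) *\<^sub>R f a i) * c a)" if "i \<in> I" for i
    proof -
      have "g l i = sqrt (p i) *\<^sub>R g' l i" using p[OF that] by (simp add: g'_def)
      then show ?thesis using c that by (simp add: scaleR_right.sum)
    qed
    then show ?thesis by blast
  qed
  ultimately show ?thesis
    by (intro exI[of _ k] conjI exI[of _ "\<lambda>a i. sqrt (p i) *\<^sub>R f a i"] allI impI)
qed

end


section \<open>Right subspaces\<close>

lemma rscale_nth [simp]: "(v *r c) $ i = v $ i * c"
  by (simp add: rscale_def)

lemma rscale_simps [simp]:
  "v *r 0 = 0" "v *r 1 = v" "0 *r c = 0" "(u + v) *r c = u *r c + v *r c"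
  "v *r (c + d) = v *r c + v *r d" "v *r c *r d = v *r (c * d)" "v *r (- c) = - (v *r c)"
  by (simp_all add: vec_eq_iff algebra_simps)

lemma rsubspace_sum:
  assumes "rsubspace V" "\<And>a. a \<in> A \<Longrightarrow> f a \<in> V"
  shows "(\<Sum>a\<in>A. f a) \<in> V"
  using assms(2)
  by (induction A rule: infinite_finite_induct) (use assms(1) in \<open>auto simp: rsubspace_def\<close>)

lemma rspan_base: "v \<in> B \<Longrightarrow> v \<in> rspan B"
  unfolding rspan_def by (intro CollectI exI[of _ "{v}"] exI[of _ "\<lambda>_. 1"]) simp

lemma rspan_minimal: "rsubspace V \<Longrightarrow> B \<subseteq> V \<Longrightarrow> rspan B \<subseteq> V"
  unfolding rspan_def by (auto intro!: rsubspace_sum) (auto simp: rsubspace_def)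

lemma rsubspace_rspan: "rsubspace (rspan B)"
  unfolding rsubspace_def
proof (intro conjI ballI allI)
  show "0 \<in> rspan B" unfolding rspan_def by (intro CollectI exI[of _ "{}"]) simp
next
  fix x y assume "x \<in> rspan B" "y \<in> rspan B"
  then obtain s t p q where *: "finite s" "s \<subseteq> B" "x = (\<Sum>v\<in>s. v *r p v)"
      "finite t" "t \<subseteq> B" "y = (\<Sum>v\<in>t. v *r q v)"
    unfolding rspan_def by auto
  have "x = (\<Sum>v\<in>s \<union> t. v *r (if v \<in> s then p v else 0))"
    unfolding * using * by (intro sum.mono_neutral_cong_left) auto
  moreover have "y = (\<Sum>v\<in>s \<union> t. v *r (if v \<in> t then q v else 0))"
    unfolding * using * by (intro sum.mono_neutral_cong_left) auto
  ultimately have "x + y = (\<Sum>v\<in>s \<union> t. v *r ((if v \<in> s then p v else 0) + (if v \<in> t then q v else 0)))"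
    by (simp add: sum.distrib)
  moreover have "finite (s \<union> t)" "s \<union> t \<subseteq> B" using * by auto
  ultimately show "x + y \<in> rspan B"
    unfolding rspan_def
    by (intro CollectI exI[of _ "s \<union> t"] exI[of _ "\<lambda>v. (if v \<in> s then p v else 0) + (if v \<in> t then q v else 0)"] conjI)
next
  fix x c assume "x \<in> rspan B"
  then obtain s p where *: "finite s" "s \<subseteq> B" "x = (\<Sum>v\<in>s. v *r p v)"
    unfolding rspan_def by auto
  have "x *r c = (\<Sum>v\<in>s. v *r (p v * c))"
    unfolding *(3) by (simp add: vec_eq_iff sum_distrib_right mult.assoc)
  then show "x *r c \<in> rspan B"
    unfolding rspan_def using * by (intro CollectI exI[of _ s] exI conjI) auto
qed

lemma rspan_mono: "A \<subseteq> B \<Longrightarrow> rspan A \<subseteq> rspan B"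
  by (intro rspan_minimal rsubspace_rspan) (auto intro: rspan_base)

lemma rspan_empty [simp]: "rspan {} = {0}"
  by (auto simp: rspan_def)

text \<open>The vectors \<open>y\<close> described on the right form a subspace containing
  \<open>x\<close> and \<open>B\<close>, so minimality of the span gives the forward
  direction.\<close>

lemma rspan_insert: "y \<in> rspan (insert x B) \<longleftrightarrow> (\<exists>c. y - x *r c \<in> rspan B)"
proof
  have "rsubspace {y. \<exists>c. y - x *r c \<in> rspan B}"
    unfolding rsubspace_def
  proof (intro conjI ballI allI; clarsimp)
    show "\<exists>c. - (x *r c) \<in> rspan B"
      using rsubspace_rspan[of B] by (intro exI[of _ 0]) (simp add: rsubspace_def)
  next
    fix u v c d assume "u - x *r c \<in> rspan B" "v - x *r d \<in> rspan B"
    then have "(u - x *r c) + (v - x *r d) \<in> rspan B"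
      using rsubspace_rspan[of B] by (simp add: rsubspace_def)
    then show "\<exists>e. u + v - x *r e \<in> rspan B"
      by (intro exI[of _ "c + d"]) (simp add: algebra_simps)
  next
    fix u c d assume "u - x *r c \<in> rspan B"
    then have "(u - x *r c) *r d \<in> rspan B"
      using rsubspace_rspan[of B] by (simp add: rsubspace_def)
    moreover have "(u - x *r c) *r d = u *r d - x *r (c * d)"
      by (simp add: vec_eq_iff algebra_simps)
    ultimately show "\<exists>e. u *r d - x *r e \<in> rspan B" by metis
  qed
  moreover have "insert x B \<subseteq> {y. \<exists>c. y - x *r c \<in> rspan B}"
  proof (safe)
    show "\<exists>c. x - x *r c \<in> rspan B"
      using rsubspace_rspan[of B] by (intro exI[of _ 1]) (simp add: rsubspace_def)
    show "\<exists>c. y - x *r c \<in> rspan B" if "y \<in> B" for y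
      using rspan_base[OF that] by (intro exI[of _ 0]) simp
  qed
  ultimately have "rspan (insert x B) \<subseteq> {y. \<exists>c. y - x *r c \<in> rspan B}"
    by (rule rspan_minimal)
  then show "y \<in> rspan (insert x B) \<Longrightarrow> \<exists>c. y - x *r c \<in> rspan B" by blast
next
  assume "\<exists>c. y - x *r c \<in> rspan B"
  then obtain c where "y - x *r c \<in> rspan B" ..
  then have "y - x *r c \<in> rspan (insert x B)" "x *r c \<in> rspan (insert x B)"
    using rspan_mono[of B "insert x B"] rspan_base[of x "insert x B"] rsubspace_rspan[of "insert x B"]
    by (auto simp: rsubspace_def)
  then have "(y - x *r c) + x *r c \<in> rspan (insert x B)"
    using rsubspace_rspan[of "insert x B"] unfolding rsubspace_def by blast
  then show "y \<in> rspan (insert x B)" by simp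
qed

text \<open>Steinitz exchange: the coefficient of \<open>x\<close> is nonzero, and multiplying by
  its inverse on the right solves for \<open>x\<close>.\<close>

lemma rspan_exchange:
  assumes "y \<in> rspan (insert x B)" "y \<notin> rspan B"
  shows "x \<in> rspan (insert y B)"
proof -
  obtain c where c: "y - x *r c \<in> rspan B" using assms(1) by (auto simp: rspan_insert)
  with assms(2) have "c \<noteq> 0" by auto
  have "(y - x *r c) *r (- inverse c) \<in> rspan B"
    using c rsubspace_rspan[of B] unfolding rsubspace_def by blast
  moreover have "(y - x *r c) *r (- inverse c) = x - y *r inverse c"
    using \<open>c \<noteq> 0\<close> by (simp add: vec_eq_iff algebra_simps)
  ultimately show ?thesis by (auto simp: rspan_insert)
qed

lemma rspan_eqI: "A \<subseteq> rspan B \<Longrightarrow> B \<subseteq> rspan A \<Longrightarrow> rspan A = rspan B"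
  by (simp add: rspan_minimal rsubspace_rspan subset_antisym)

lemma rspan_singleton: "rspan {v} = range (\<lambda>c. v *r c)"
  by (auto simp: rspan_insert)

lemma rspan_pair: "y \<in> rspan {u, v} \<longleftrightarrow> (\<exists>a b. y = u *r a + v *r b)"
  by (simp add: rspan_insert diff_diff_eq)

text \<open>Two exchanges replace \<open>p\<close> and \<open>q\<close> by \<open>u\<close> and
  \<open>v\<close>. Which generator \<open>u\<close> replaces depends on whether \<open>u\<close> is
  a multiple of \<open>q\<close>.\<close>

lemma rspan_pair_eqI:
  assumes u: "u \<in> rspan {p, q}" "u \<noteq> 0" and v: "v \<in> rspan {p, q}" "v \<notin> rspan {u}"
  shows "rspan {p, q} = rspan {u, v}"
proof (rule rspan_eqI)
  show "{p, q} \<subseteq> rspan {u, v}"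
  proof (cases "u \<in> rspan {q}")
    case False
    then have p: "p \<in> rspan {u, q}" using u rspan_exchange by blast
    then have "rspan {p, q} \<subseteq> rspan {q, u}"
      by (intro rspan_minimal rsubspace_rspan) (auto intro: rspan_base simp: insert_commute)
    then have "q \<in> rspan {v, u}" using v rspan_exchange by blast
    moreover from this have "rspan {u, q} \<subseteq> rspan {u, v}"
      by (intro rspan_minimal rsubspace_rspan) (auto intro: rspan_base simp: insert_commute)
    ultimately show ?thesis using p by (auto simp: insert_commute)
  next
    case True
    then have q: "q \<in> rspan {u}" using rspan_exchange[of u q "{}"] u by simp
    then have "rspan {p, q} \<subseteq> rspan {p, u}"
      using rspan_mono[of "{u}" "{p, u}"]
      by (intro rspan_minimal rsubspace_rspan) (auto intro: rspan_base)
    then have "p \<in> rspan {v, u}" using v rspan_exchange by blast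
    moreover have "q \<in> rspan {u, v}" using q rspan_mono[of "{u}" "{u, v}"] by auto
    ultimately show ?thesis by (auto simp: insert_commute)
  qed
qed (use u v in auto)

section \<open>Points and lines as spans of vectors\<close>

lemma proj_point_rspan:
  assumes "proj_point x"
  obtains v where "v \<noteq> 0" "x = rspan {v}"
proof -
  obtain B where B: "card B = 1" "rindependent B" "rspan B = x"
    using assms by (auto simp: proj_flat_def has_rdim_def)
  then obtain v where v: "B = {v}" by (auto simp: card_1_singleton_iff)
  have "v \<noteq> 0"
  proof
    assume "v = 0"
    then show False
      using B(2)[unfolded rindependent_def v, rule_format, of "{v}" "\<lambda>_. 1" v] by simp
  qed
  then show thesis using that B v by blast
qed

lemma proj_line_rspan:
  assumes "proj_line L"
  obtains p q where "L = rspan {p, q}"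
proof -
  obtain B where "card B = 2" "rspan B = L"
    using assms by (auto simp: proj_flat_def has_rdim_def numeral_2_eq_2)
  then show thesis using that by (auto simp: card_2_iff)
qed

section \<open>Flats spanned by orthonormal families\<close>

text \<open>Pairing a vanishing combination with one of its vectors isolates that coefficient, which
  gives independence; injectivity ensures that there are \<open>Suc k\<close> basis vectors.\<close>

lemma proj_flat_orthonormal:
  fixes f :: "nat \<Rightarrow> 'n::finite \<Rightarrow> quat"
  assumes on: "qorthonormal UNIV (Suc k) f"
  shows "proj_flat k (rspan ((\<lambda>a. \<chi> i. f a i) ` {..<Suc k}) :: (quat ^ 'n) set)"
proof -
  define V :: "nat \<Rightarrow> quat ^ 'n" where "V = (\<lambda>a. \<chi> i. f a i)"
  have V: "qinner UNIV (($) (V a)) (($) (V b)) = (if a = b then 1 else 0)" if "a < Suc k" "b < Suc k" for a b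
  proof -
    have "($) (V a) = f a" for a by (rule ext) (simp add: V_def)
    then show ?thesis using on that by (simp add: qorthonormal_def)
  qed
  have inj: "inj_on V {..<Suc k}"
  proof (rule inj_onI)
    fix a b assume "a \<in> {..<Suc k}" "b \<in> {..<Suc k}" "V a = V b"
    then show "a = b" using V[of a b] V[of b b] by (auto split: if_splits)
  qed
  have VV: "qinner UNIV (($) x) (($) y) = (if x = y then 1 else 0)" if "x \<in> V ` {..<Suc k}" "y \<in> V ` {..<Suc k}" for x y
    using that V inj by (auto simp: inj_on_eq_iff)
  have "rindependent (V ` {..<Suc k})"
    unfolding rindependent_def
  proof (intro allI impI ballI)
    fix t u x assume t: "finite t" "t \<subseteq> V ` {..<Suc k}" "(\<Sum>v\<in>t. v *r u v) = 0" and x: "x \<in> t"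
    have "(\<Sum>v\<in>t. v $ i * u v) = 0" for i
      using arg_cong[OF t(3), of "\<lambda>z. z $ i"] by simp
    then have "0 = qinner UNIV (($) x) (\<lambda>i. \<Sum>v\<in>t. v $ i * u v)"
      by (simp add: qinner_def)
    also have "\<dots> = (\<Sum>v\<in>t. if x = v then u v else 0)"
      unfolding qinner_combination
    proof (intro sum.cong refl)
      fix v assume "v \<in> t"
      then have "qinner UNIV (($) x) (($) v) = (if x = v then 1 else 0)" using t x by (intro VV) auto
      then show "qinner UNIV (($) x) (($) v) * u v = (if x = v then u v else 0)" by simp
    qed
    also have "\<dots> = u x" using t x by simp
    finally show "u x = 0" by simp
  qed
  then show ?thesis
    unfolding proj_flat_def has_rdim_def V_def[symmetric]
    using inj by (auto simp: rsubspace_rspan card_image intro!: exI[of _ "V ` {..<Suc k}"])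
qed

text \<open>The given vectors may be dependent or too few, so they are orthonormalised and the
  family is then completed to exactly \<open>Suc k\<close> members.\<close>

lemma proj_flat_containing:
  fixes g :: "nat \<Rightarrow> quat ^ 'n"
  assumes "m \<le> Suc k" "k < CARD('n)"
  obtains F where "proj_flat k F" "\<And>l. l < m \<Longrightarrow> g l \<in> F"
proof -
  obtain m' f where m': "m' \<le> m" and on: "qorthonormal UNIV m' f"
    and f: "\<And>l. l < m \<Longrightarrow> \<exists>c. \<forall>i\<in>UNIV. g l $ i = (\<Sum>a<m'. f a i * c a)"
    using gram_schmidt[of "UNIV :: 'n set" m "\<lambda>l i. g l $ i"] by auto
  obtain f' where on': "qorthonormal UNIV (Suc k) f'" and f': "\<forall>a<m'. f' a = f a"
    using qorthonormal_extend_to[OF finite_class.finite_UNIV on, of "Suc k"] m' assms by auto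
  define F :: "(quat ^ 'n) set" where "F = rspan ((\<lambda>a. \<chi> i. f' a i) ` {..<Suc k})"
  have "g l \<in> F" if l: "l < m" for l
  proof -
    obtain c where "\<forall>i. g l $ i = (\<Sum>a<m'. f a i * c a)" using f[OF l] by auto
    then have "g l = (\<Sum>a<m'. (\<chi> i. f' a i) *r c a)" using f' by (simp add: vec_eq_iff)
    also have "\<dots> \<in> F"
    proof (rule rsubspace_sum)
      show "rsubspace F" by (simp add: F_def rsubspace_rspan)
      show "(\<chi> i. f' a i) *r c a \<in> F" if "a \<in> {..<m'}" for a
      proof -
        have "(\<chi> i. f' a i) \<in> F" unfolding F_def using that m' assms by (intro rspan_base imageI) auto
        with \<open>rsubspace F\<close> show ?thesis by (simp add: rsubspace_def)
      qed
    qed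
    finally show ?thesis .
  qed
  then show thesis using that proj_flat_orthonormal[OF on'] F_def by blast
qed


section \<open>The design of a Sylvester--Gallai configuration\<close>

text \<open>The coordinate functions of the representing vectors satisfy all relations of the
  design, so \<open>dimension_le_3\<close> factors them through at most three functions. Read along
  the other index, the factorisation gives at most three generators: row rank against column
  rank.\<close>

lemma sylvester_gallai_generators:
  fixes S :: "(quat ^ 'n) set set"
  assumes SG: "sylvester_gallai S"
  shows "\<exists>k\<le>3. \<exists>g :: nat \<Rightarrow> quat ^ 'n. \<forall>x\<in>S. \<exists>v. x = rspan {v} \<and> (\<exists>c. v = (\<Sum>a<k. g a *r c a))"
proof -
  have finS: "finite S" using SG by (simp add: sylvester_gallai_def)
  have "\<forall>x\<in>S. \<exists>v. v \<noteq> 0 \<and> x = rspan {v}"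
    using SG proj_point_rspan unfolding sylvester_gallai_def by metis
  then obtain v where v: "\<And>x. x \<in> S \<Longrightarrow> v x \<noteq> 0" "\<And>x. x \<in> S \<Longrightarrow> x = rspan {v x}"
    by metis
  have indep: "v x \<notin> rspan {v y}" if "x \<in> S" "y \<in> S" "x \<noteq> y" for x y
  proof
    assume *: "v x \<in> rspan {v y}"
    then have "v y \<in> rspan {v x}" using rspan_exchange[of "v x" "v y" "{}"] v(1)[OF that(1)] by simp
    with * have "rspan {v x} = rspan {v y}" by (intro rspan_eqI) auto
    then show False using v(2) that by metis
  qed
  have third: "\<exists>z\<in>S. z \<noteq> x \<and> z \<noteq> y \<and> v z \<in> rspan {v x, v y}" if xy: "x \<in> S" "y \<in> S" "x \<noteq> y" for x y
  proof -
    obtain z where z: "z \<in> S" "z \<noteq> x" "z \<noteq> y" "proj_collinear x y z"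
      using SG xy unfolding sylvester_gallai_def by blast
    then obtain L where "proj_line L" and L: "x \<subseteq> L" "y \<subseteq> L" "z \<subseteq> L"
      by (auto simp: proj_collinear_def)
    then obtain p q where pq: "L = rspan {p, q}" using proj_line_rspan by blast
    have "v t \<in> t" if "t \<in> S" for t
      using v(2)[OF that] rspan_base[of "v t" "{v t}"] by auto
    then have "v x \<in> rspan {p, q}" "v y \<in> rspan {p, q}" "v z \<in> rspan {p, q}"
      using L pq xy z by blast+
    then have "v z \<in> rspan {v x, v y}"
      using rspan_pair_eqI[of "v x" p q "v y"] v(1)[OF xy(1)] indep[of y x] xy by auto
    with z show ?thesis by blast
  qed
  \<comment> \<open>The collinear triples: two distinct members span all three.\<close>
  define T where "T = {A. A \<subseteq> S \<and> card A = 3 \<and> (\<exists>x\<in>A. \<exists>y\<in>A. x \<noteq> y \<and> v ` A \<subseteq> rspan {v x, v y})}"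
  have T_span: "rspan (v ` A) = rspan {v i, v j}" if A: "A \<in> T" "i \<in> A" "j \<in> A" "i \<noteq> j" for A i j
  proof -
    obtain x y where xy: "v ` A \<subseteq> rspan {v x, v y}" "A \<subseteq> S" using A by (auto simp: T_def)
    have "rspan {v x, v y} = rspan {v i, v j}"
      by (rule rspan_pair_eqI) (use A xy v(1) indep[of j i] in auto)
    with xy(1) show ?thesis using A by (intro rspan_eqI) (auto intro: rspan_base)
  qed
  \<comment> \<open>A vanishing coefficient would make two of the three points equal, so the
    relation has support exactly \<open>A\<close>.\<close>
  have "\<exists>c. (\<forall>i\<in>S. c i \<noteq> 0 \<longleftrightarrow> i \<in> A) \<and> (\<Sum>i\<in>S. v i *r c i) = 0" if A: "A \<in> T" for A
  proof -
    obtain i j k where ijk: "A = {i, j, k}" "i \<noteq> j" "i \<noteq> k" "j \<noteq> k"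
      using A by (auto simp: T_def card_3_iff)
    have S: "i \<in> S" "j \<in> S" "k \<in> S" using A ijk by (auto simp: T_def)
    have "v k \<in> rspan {v i, v j}"
      using T_span[OF A, of i j] rspan_base[of "v k" "v ` A"] ijk by auto
    then obtain a b where ab: "v k = v i *r a + v j *r b" by (auto simp: rspan_pair)
    have "a \<noteq> 0"
      using indep[of k j] S ijk ab by (auto simp: rspan_singleton)
    moreover have "b \<noteq> 0"
      using indep[of k i] S ijk ab by (auto simp: rspan_singleton)
    moreover define c where "c = (\<lambda>t. if t = i then a else if t = j then b else if t = k then - 1 else 0)"
    moreover have "(\<Sum>t\<in>S. v t *r c t) = (\<Sum>t\<in>A. v t *r c t)"
      using finS S ijk by (intro sum.mono_neutral_right) (auto simp: c_def)
    moreover have "(\<Sum>t\<in>A. v t *r c t) = 0"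
      using ijk ab by (simp add: c_def)
    ultimately show ?thesis using ijk by (intro exI[of _ c]) auto
  qed
  then obtain c where c: "\<And>A i. A \<in> T \<Longrightarrow> i \<in> S \<Longrightarrow> c A i \<noteq> 0 \<longleftrightarrow> i \<in> A"
    and rel: "\<And>A. A \<in> T \<Longrightarrow> (\<Sum>i\<in>S. v i *r c A i) = 0"
    by metis
  \<comment> \<open>One over the number of third points on the line of \<open>A\<close>. That line
    contains the three points of \<open>A\<close>, so the natural subtraction does not
    truncate.\<close>
  define w where "w = (\<lambda>A. 1 / real (card {z \<in> S. v z \<in> rspan (v ` A)} - 2))"
  \<comment> \<open>The relations have their coefficients on the right, whereas a design multiplies
    from the left; conjugation exchanges the sides.\<close>
  interpret triple_design S T w "\<lambda>A i. qcnj (c A i)"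
  proof
    show "finite S" by (fact finS)
    have "T \<subseteq> Pow S" by (auto simp: T_def)
    then show "finite T" using finS by (simp add: finite_subset)
    show "w A \<ge> 0" for A by (simp add: w_def)
    show "card {i \<in> S. qcnj (c A i) \<noteq> 0} = 3" if "A \<in> T" for A
    proof -
      have "{i \<in> S. qcnj (c A i) \<noteq> 0} = A" using c[OF that] that by (auto simp: T_def)
      then show ?thesis using that by (simp add: T_def)
    qed
    show "(\<Sum>A\<in>T. w A * of_bool (qcnj (c A i) \<noteq> 0 \<and> qcnj (c A j) \<noteq> 0)) = 1"
      if ij: "i \<in> S" "j \<in> S" "i \<noteq> j" for i j
    proof -
      define L where "L = {z \<in> S. v z \<in> rspan {v i, v j}}"
      have L: "finite L" "i \<in> L" "j \<in> L" using ij finS by (auto simp: L_def intro: rspan_base)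
      have card_L: "card (L - {i, j}) = card L - 2" using L ij by (simp add: card_Diff_subset)
      \<comment> \<open>Triples through \<open>i\<close> and \<open>j\<close> correspond to the
        further points of their line.\<close>
      have through: "{A \<in> T. i \<in> A \<and> j \<in> A} = (\<lambda>z. {i, j, z}) ` (L - {i, j})"
      proof (intro equalityI subsetI)
        fix A assume "A \<in> {A \<in> T. i \<in> A \<and> j \<in> A}"
        then have A: "A \<in> T" "i \<in> A" "j \<in> A" by auto
        then have "card A = 3" "A \<subseteq> S" by (auto simp: T_def)
        then have "card (A - {i, j}) = 1" using A ij by (simp add: card_Diff_subset)
        then obtain z where z: "A - {i, j} = {z}" by (auto simp: card_1_singleton_iff)
        then have "A = {i, j, z}" "z \<in> A" "z \<notin> {i, j}" using A by auto
        moreover have "v z \<in> rspan {v i, v j}"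
          using T_span[OF A ij(3)] rspan_base[of "v z" "v ` A"] \<open>z \<in> A\<close> by auto
        ultimately show "A \<in> (\<lambda>z. {i, j, z}) ` (L - {i, j})"
          using \<open>A \<subseteq> S\<close> by (auto simp: L_def)
      next
        fix A assume "A \<in> (\<lambda>z. {i, j, z}) ` (L - {i, j})"
        then obtain z where z: "z \<in> L" "z \<noteq> i" "z \<noteq> j" "A = {i, j, z}" by auto
        then have "card A = 3" "A \<subseteq> S" "v ` A \<subseteq> rspan {v i, v j}"
          using ij by (auto simp: L_def intro: rspan_base)
        then show "A \<in> {A \<in> T. i \<in> A \<and> j \<in> A}" using z ij by (auto simp: T_def)
      qed
      have inj: "inj_on (\<lambda>z. {i, j, z}) (L - {i, j})"
        by (rule inj_onI) (auto simp: insert_eq_iff doubleton_eq_iff)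
      \<comment> \<open>The Sylvester-Gallai property enters the weights here: the line has a third
        point, so their common denominator is positive.\<close>
      have "L - {i, j} \<noteq> {}" using third[OF ij] by (auto simp: L_def)
      then have pos: "card L - 2 > 0" using L card_L card_gt_0_iff[of "L - {i, j}"] by simp
      have "(\<Sum>A\<in>T. w A * of_bool (qcnj (c A i) \<noteq> 0 \<and> qcnj (c A j) \<noteq> 0))
        = (\<Sum>A\<in>T. if i \<in> A \<and> j \<in> A then w A else 0)"
        using c ij by (intro sum.cong) auto
      also have "\<dots> = (\<Sum>A\<in>{A \<in> T. i \<in> A \<and> j \<in> A}. w A)"
        using \<open>finite T\<close> by (simp add: sum.inter_filter)
      also have "\<dots> = (\<Sum>A\<in>{A \<in> T. i \<in> A \<and> j \<in> A}. 1 / real (card L - 2))"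
      proof (rule sum.cong[OF refl])
        fix A assume "A \<in> {A \<in> T. i \<in> A \<and> j \<in> A}"
        then have "rspan (v ` A) = rspan {v i, v j}" using ij by (intro T_span) auto
        then show "w A = 1 / real (card L - 2)" by (simp add: w_def L_def)
      qed
      also have "\<dots> = 1"
        unfolding through using pos by (simp add: card_image[OF inj] card_L)
      finally show ?thesis .
    qed
  qed
  \<comment> \<open>Coordinates are enumerated because \<open>dimension_le_3\<close> indexes its
    functions by natural numbers.\<close>
  obtain h where h: "bij_betw h {0..<CARD('n)} (UNIV :: 'n set)"
    using ex_bij_betw_nat_finite[of "UNIV :: 'n set"] by auto
  have "(\<Sum>x\<in>S. qcnj (c A x) * qcnj (v x $ h l)) = 0" if "A \<in> T" for A l
  proof -
    have "(\<Sum>x\<in>S. v x $ h l * c A x) = 0"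
      using arg_cong[OF rel[OF that], of "\<lambda>z. z $ h l"] by simp
    then have "qcnj (\<Sum>x\<in>S. v x $ h l * c A x) = 0" by simp
    then show ?thesis unfolding qcnj_sum by simp
  qed
  then obtain k :: nat and f where k: "k \<le> 3" and f: "\<And>l. l < CARD('n) \<Longrightarrow>
      \<exists>d. \<forall>x\<in>S. qcnj (v x $ h l) = (\<Sum>a<k. f a x * d a)"
    using dimension_le_3[of "CARD('n)" "\<lambda>l x. qcnj (v x $ h l)"] by blast
  have "\<forall>j. \<exists>d. \<forall>x\<in>S. qcnj (v x $ j) = (\<Sum>a<k. f a x * d a)"
  proof
    fix j
    have "j \<in> h ` {0..<CARD('n)}" using bij_betw_imp_surj_on[OF h] by simp
    then obtain l where "l < CARD('n)" "h l = j" by auto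
    then show "\<exists>d. \<forall>x\<in>S. qcnj (v x $ j) = (\<Sum>a<k. f a x * d a)" using f by blast
  qed
  then obtain d where d: "\<And>j x. x \<in> S \<Longrightarrow> qcnj (v x $ j) = (\<Sum>a<k. f a x * d j a)" by metis
  \<comment> \<open>Conjugating the factorisation turns the coefficients \<open>d j a\<close> into
    generating vectors and the values \<open>f a x\<close> into right scalars.\<close>
  have "v x = (\<Sum>a<k. (\<chi> j. qcnj (d j a)) *r qcnj (f a x))" if "x \<in> S" for x
  proof -
    have "v x $ j = (\<Sum>a<k. qcnj (d j a) * qcnj (f a x))" for j
      using arg_cong[OF d[OF that, of j], of qcnj] by (simp add: qcnj_sum)
    then show ?thesis by (simp add: vec_eq_iff)
  qed
  then have "\<exists>u. x = rspan {u} \<and> (\<exists>e. u = (\<Sum>a<k. (\<chi> j. qcnj (d j a)) *r e a))" if "x \<in> S" for x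
    using v(2)[OF that] that by (intro exI[of _ "v x"] conjI exI[of _ "\<lambda>a. qcnj (f a x)"])
  then show ?thesis
    using k by (intro exI[of _ k] conjI exI[of _ "\<lambda>a. \<chi> j. qcnj (d j a)"] ballI)
qed

section \<open>The enclosing three-dimensional flat\<close>

theorem theorem3:
  fixes n :: nat and S :: "(quat ^ 'n) set set"
  assumes "n > 0"
    and "CARD('n) = n + 1"
    and "sylvester_gallai S"
  shows "n \<ge> 3 \<longrightarrow> (\<exists>F. proj_flat 3 F \<and> (\<forall>x\<in>S. x \<subseteq> F))"
proof
  assume "n \<ge> 3"
  obtain k and g :: "nat \<Rightarrow> quat ^ 'n" where "k \<le> 3"
    and g: "\<forall>x\<in>S. \<exists>v. x = rspan {v} \<and> (\<exists>c. v = (\<Sum>a<k. g a *r c a))"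
    using sylvester_gallai_generators[OF assms(3)] by blast
  \<comment> \<open>At most three generators fit into a four-dimensional subspace, which exists
    since \<open>CARD('n) = n + 1\<close> exceeds 3.\<close>
  then obtain F where F: "proj_flat 3 F" "\<And>l. l < k \<Longrightarrow> g l \<in> F"
    using proj_flat_containing[of k 3 g] assms(2) \<open>n \<ge> 3\<close> by auto
  have sub: "rsubspace F" using F(1) by (simp add: proj_flat_def)
  have "x \<subseteq> F" if x: "x \<in> S" for x
  proof -
    obtain v c where v: "x = rspan {v}" "v = (\<Sum>a<k. g a *r c a)" using g x by blast
    have "v \<in> F"
      unfolding v(2) using F(2) sub by (intro rsubspace_sum) (auto simp: rsubspace_def)
    then show ?thesis unfolding v(1) using sub by (intro rspan_minimal) auto
  qed
  with F(1) show "\<exists>F. proj_flat 3 F \<and> (\<forall>x\<in>S. x \<subseteq> F)" by blast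
qed

end
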